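(* Consider the standard bifactor model with probit link and let $(A,\mathbf d)\in\mathfrak P$. The model is identifiable at $(A,\mathbf d)$ if and only if at least one of the following two conditions holds: (P1) $|\mathcal H_1|\ge 3$, and $|\mathcal Q_g|\ge 3$ for all $g=1,\dots,G$; (P2) $|\mathcal H_1|=2$, $\mathcal H_2$ is non-empty, and $|\mathcal Q_g|\ge 3$ for all $g=1,\dots,G$.
   Context: Standard bifactor model with probit link. Fix $G\ge 1$ and items $\{1,\dots,J\}$ with a fixed known partition into $G$ nonempty testlets $\mathcal B_1,\dots,\mathcal B_G$; $g_j$ is the testlet containing item $j$. Parameters: a real $J\times(1+G)$ loading matrix $A=[\mathbf a_0,\mathbf a_1,\dots,\mathbf a_G]$ with $\mathbf a_g[j]=0$ whenever $g\ge1$ and $g\ne g_j$ (the other entries are arbitrary reals, possibly zero), and intercepts $\mathbf d\in\mathbb R^J$. The observed responses $Y_1,\dots,Y_J\in\{0,1\}$ are conditionally independent given $\boldsymbol\eta=(\eta_0,\eta_1,\dots,\eta_G)^T\sim N(\mathbf 0,I_{1+G})$, with $$P(Y_j=1\mid\boldsymbol\eta)=\Phi\big(d_j+\mathbf a_0[j]\,\eta_0+\mathbf a_{g_j}[j]\,\eta_{g_j}\big),$$ where $\Phi$ is the standard normal distribution function. The parameter space $\mathfrak P$ is the set of all such $(A,\mathbf d)$ for which the first nonzero entry of every column of $A$ is positive (no requirement on a zero column). The model is identifiable at $(A,\mathbf d)\in\mathfrak P$ if every $(A',\mathbf d')\in\mathfrak P$ that defines the same (marginal) distribution of $(Y_1,\dots,Y_J)$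 equals $(A,\mathbf d)$. Notation: $x[\mathcal B]$ is the subvector of $x$ with entries in $\mathcal B$; $M[\mathcal B,:]$ is the submatrix of rows indexed by $\mathcal B$; $\bar A_g=(\mathbf a_0[\mathcal B_g],\mathbf a_g[\mathcal B_g])$ is the $|\mathcal B_g|\times 2$ matrix of main and testlet loadings of testlet $g$ (rows indexed by $\mathcal B_g$). - $\mathcal Q_g=\{j:\mathbf a_g[j]\ne 0\}$ for $g=1,\dots,G$. - $\mathcal H_1=\{g\in\{1,\dots,G\}:\mathbf a_0[\mathcal B_g]\ne\mathbf 0\}$. - $\mathcal H_2$ is the set of $g\in\{1,\dots,G\}$ for which there is a partition $\mathcal B_g=\mathcal B_{g,1}\cup\mathcal B_{g,2}$, $\mathcal B_{g,1}\cap\mathcal B_{g,2}=\emptyset$, such that both $\bar A_g[\mathcal B_{g,1},:]$ and $\bar A_g[\mathcal B_{g,2},:]$ have full column rank (rank 2). *)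

theory Defs
  imports
    "HOL-Probability.Probability"
    "Jordan_Normal_Form.DL_Rank"
    "Jordan_Normal_Form.DL_Submatrix"
begin

(* Items are numbered 0, ..., J - 1 and testlets 1, ..., G; testlet j is the testlet of item j.
   Column 0 of a loading matrix holds the main loadings, column g the loadings of testlet g. *)

definition testlet_assignment :: "nat \<Rightarrow> nat \<Rightarrow> (nat \<Rightarrow> nat) \<Rightarrow> bool" where
  "testlet_assignment J G testlet \<longleftrightarrow> testlet ` {..<J} = {1..G}"

definition testlet_items :: "nat \<Rightarrow> (nat \<Rightarrow> nat) \<Rightarrow> nat \<Rightarrow> nat set" where
  "testlet_items J testlet g = {j \<in> {..<J}. testlet j = g}"

definition Phi :: "real \<Rightarrow> real" where
  "Phi = cdf std_normal_distribution"

(* The law N(0, I) of the factors eta 0, ..., eta G, as a product of standard normal laws. *)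
definition factor_law :: "nat \<Rightarrow> (nat \<Rightarrow> real) measure" where
  "factor_law G = PiM {0..G} (\<lambda>_. std_normal_distribution)"

definition item_response_prob ::
  "(nat \<Rightarrow> nat) \<Rightarrow> real mat \<Rightarrow> real vec \<Rightarrow> (nat \<Rightarrow> real) \<Rightarrow> nat \<Rightarrow> real" where
  "item_response_prob testlet A d \<eta> j =
     Phi (d $ j + A $$ (j, 0) * \<eta> 0 + A $$ (j, testlet j) * \<eta> (testlet j))"

(* A response pattern is a function that is False outside of {..<J}. *)
definition conditional_response_law ::
  "nat \<Rightarrow> (nat \<Rightarrow> nat) \<Rightarrow> real mat \<Rightarrow> real vec \<Rightarrow> (nat \<Rightarrow> real) \<Rightarrow> (nat \<Rightarrow> bool) pmf" where
  "conditional_response_law J testlet A d \<eta> =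
     Pi_pmf {..<J} False (\<lambda>j. bernoulli_pmf (item_response_prob testlet A d \<eta> j))"

definition response_law ::
  "nat \<Rightarrow> nat \<Rightarrow> (nat \<Rightarrow> nat) \<Rightarrow> real mat \<Rightarrow> real vec \<Rightarrow> (nat \<Rightarrow> bool) measure" where
  "response_law J G testlet A d =
     factor_law G \<bind> (\<lambda>\<eta>. measure_pmf (conditional_response_law J testlet A d \<eta>))"

definition parameter_space ::
  "nat \<Rightarrow> nat \<Rightarrow> (nat \<Rightarrow> nat) \<Rightarrow> (real mat \<times> real vec) set" where
  "parameter_space J G testlet =
     {(A, d). A \<in> carrier_mat J (1 + G) \<and> d \<in> carrier_vec J \<and>
        (\<forall>j<J. \<forall>g\<in>{1..G}. g \<noteq> testlet j \<longrightarrow> A $$ (j, g) = 0) \<and>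
        (\<forall>g\<le>G. \<forall>j<J. A $$ (j, g) \<noteq> 0 \<and> (\<forall>i<j. A $$ (i, g) = 0) \<longrightarrow> A $$ (j, g) > 0)}"

definition identifiable_at ::
  "nat \<Rightarrow> nat \<Rightarrow> (nat \<Rightarrow> nat) \<Rightarrow> real mat \<Rightarrow> real vec \<Rightarrow> bool" where
  "identifiable_at J G testlet A d \<longleftrightarrow>
     (\<forall>(A', d') \<in> parameter_space J G testlet.
        response_law J G testlet A' d' = response_law J G testlet A d \<longrightarrow> (A', d') = (A, d))"

definition Q_set :: "nat \<Rightarrow> real mat \<Rightarrow> nat \<Rightarrow> nat set" where
  "Q_set J A g = {j \<in> {..<J}. A $$ (j, g) \<noteq> 0}"

definition H1_set :: "nat \<Rightarrow> nat \<Rightarrow> (nat \<Rightarrow> nat) \<Rightarrow> real mat \<Rightarrow> nat set" where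
  "H1_set J G testlet A = {g \<in> {1..G}. \<exists>j \<in> testlet_items J testlet g. A $$ (j, 0) \<noteq> 0}"

definition mat_rank :: "real mat \<Rightarrow> nat" where
  "mat_rank M = vec_space.rank (dim_row M) M"

(* For B contained in testlet g, submatrix A B {0, g} is the block with rows B of the
   two-column matrix of main and testlet loadings of testlet g. *)
definition H2_set :: "nat \<Rightarrow> nat \<Rightarrow> (nat \<Rightarrow> nat) \<Rightarrow> real mat \<Rightarrow> nat set" where
  "H2_set J G testlet A =
     {g \<in> {1..G}. \<exists>B1 B2. B1 \<union> B2 = testlet_items J testlet g \<and> B1 \<inter> B2 = {} \<and>
        mat_rank (submatrix A B1 {0, g}) = 2 \<and> mat_rank (submatrix A B2 {0, g}) = 2}"

(* The remaining facts confirm that the Giry bind in response_law is taken of a probability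
   kernel, and that response_law has the usual marginal probabilities. *)

lemma Phi_nonneg: "0 \<le> Phi x" and Phi_le_1: "Phi x \<le> 1"
proof -
  interpret real_distribution std_normal_distribution
    by (rule real_dist_normal_dist)
  show "0 \<le> Phi x" "Phi x \<le> 1"
    unfolding Phi_def by (rule cdf_nonneg, rule cdf_bounded_prob)
qed

lemma borel_measurable_Phi [measurable]: "Phi \<in> borel_measurable borel"
proof -
  interpret real_distribution std_normal_distribution
    by (rule real_dist_normal_dist)
  show ?thesis
    unfolding Phi_def by (intro borel_measurable_mono) (auto simp: mono_def cdf_nondecreasing)
qed

lemma prob_space_factor_law: "prob_space (factor_law G)"
  unfolding factor_law_def by (intro prob_space_PiM prob_space_normal_density) simp

lemma pmf_conditional_response_law:
  assumes "\<And>j. j \<ge> J \<Longrightarrow> \<not> y j"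
  shows "pmf (conditional_response_law J testlet A d \<eta>) y =
    (\<Prod>j<J. if y j then item_response_prob testlet A d \<eta> j
                else 1 - item_response_prob testlet A d \<eta> j)"
  unfolding conditional_response_law_def
  by (subst pmf_Pi')
     (use assms in \<open>auto intro!: prod.cong simp: item_response_prob_def Phi_nonneg Phi_le_1\<close>)

lemma measurable_item_response_prob:
  assumes "testlet_assignment J G testlet" "j < J"
  shows "(\<lambda>\<eta>. item_response_prob testlet A d \<eta> j) \<in> borel_measurable (factor_law G)"
proof -
  have "testlet j \<in> {0..G}"
    using assms unfolding testlet_assignment_def by force
  moreover have "(\<lambda>\<eta>. \<eta> i) \<in> borel_measurable (factor_law G)" if "i \<in> {0..G}" for i
    using measurable_component_singleton[OF that, of "\<lambda>_. std_normal_distribution"]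
    by (simp add: factor_law_def measurable_cong_sets[OF refl sets_density])
  ultimately have [measurable]: "(\<lambda>\<eta>. \<eta> (testlet j)) \<in> borel_measurable (factor_law G)"
    "(\<lambda>\<eta>. \<eta> 0) \<in> borel_measurable (factor_law G)"
    by auto
  show ?thesis
    unfolding item_response_prob_def by measurable
qed

lemma measurable_pmf_conditional_response_law:
  assumes "testlet_assignment J G testlet"
  shows "(\<lambda>\<eta>. pmf (conditional_response_law J testlet A d \<eta>) y) \<in> borel_measurable (factor_law G)"
proof (cases "\<exists>j\<ge>J. y j")
  case True
  then have "pmf (conditional_response_law J testlet A d \<eta>) y = 0" for \<eta>
    unfolding conditional_response_law_def by (subst pmf_Pi) auto
  then show ?thesis by simp
next
  case False
  then show ?thesis
    using measurable_item_response_prob[OF assms]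
    by (subst pmf_conditional_response_law) (auto intro!: borel_measurable_prod)
qed

lemma measurable_conditional_response_law:
  assumes "testlet_assignment J G testlet"
  shows "(\<lambda>\<eta>. measure_pmf (conditional_response_law J testlet A d \<eta>))
    \<in> factor_law G \<rightarrow>\<^sub>M prob_algebra (count_space UNIV)"
proof (rule measurable_prob_algebraI)
  let ?K = "conditional_response_law J testlet A d"
  show "prob_space (measure_pmf (?K \<eta>))" for \<eta>
    by (rule prob_space_measure_pmf)
  show "(\<lambda>\<eta>. measure_pmf (?K \<eta>)) \<in> factor_law G \<rightarrow>\<^sub>M subprob_algebra (count_space UNIV)"
  proof (rule measurable_subprob_algebra)
    fix X :: "(nat \<Rightarrow> bool) set"
    let ?S = "PiE_dflt {..<J} False (\<lambda>_. UNIV :: bool set)"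
    have fin: "finite (X \<inter> ?S)"
      by (intro finite_Int disjI2 finite_PiE_dflt) auto
    have "set_pmf (?K \<eta>) \<subseteq> ?S" for \<eta>
      unfolding conditional_response_law_def
      using set_Pi_pmf_subset'[of "{..<J}" False] by (force simp: PiE_dflt_def)
    then have "emeasure (measure_pmf (?K \<eta>)) X = emeasure (measure_pmf (?K \<eta>)) (X \<inter> ?S)" for \<eta>
      by (intro emeasure_eq_AE) (auto simp: AE_measure_pmf_iff)
    then have "emeasure (measure_pmf (?K \<eta>)) X = (\<Sum>y\<in>X \<inter> ?S. ennreal (pmf (?K \<eta>) y))" for \<eta>
      by (simp add: emeasure_measure_pmf_finite[OF fin])
    then show "(\<lambda>\<eta>. emeasure (measure_pmf (?K \<eta>)) X) \<in> borel_measurable (factor_law G)"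
      using measurable_pmf_conditional_response_law[OF assms] by auto
  qed (auto intro: prob_space_imp_subprob_space prob_space_measure_pmf)
qed

lemma prob_space_response_law:
  assumes "testlet_assignment J G testlet"
  shows "prob_space (response_law J G testlet A d)"
  unfolding response_law_def
  by (rule prob_space_bind'[OF _ measurable_conditional_response_law[OF assms]])
     (simp add: space_prob_algebra prob_space_factor_law)

lemma sets_response_law:
  assumes "testlet_assignment J G testlet"
  shows "sets (response_law J G testlet A d) = UNIV"
  unfolding response_law_def
  by (subst sets_bind'[OF _ measurable_conditional_response_law[OF assms]])
     (simp_all add: space_prob_algebra prob_space_factor_law)

lemma measure_response_law:
  assumes "testlet_assignment J G testlet" "\<And>j. j \<ge> J \<Longrightarrow> \<not> y j"
  shows "measure (response_law J G testlet A d) {y} =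
    (\<integral>\<eta>. (\<Prod>j<J. if y j then item_response_prob testlet A d \<eta> j
                   else 1 - item_response_prob testlet A d \<eta> j) \<partial>factor_law G)"
proof -
  interpret prob_space "factor_law G" by (rule prob_space_factor_law)
  have "measure (response_law J G testlet A d) {y} =
    (\<integral>\<eta>. pmf (conditional_response_law J testlet A d \<eta>) y \<partial>factor_law G)"
    unfolding response_law_def
    by (subst measure_bind[where N = "count_space UNIV"])
       (auto intro: measurable_prob_algebraD measurable_conditional_response_law[OF assms(1)]
          simp: pmf.rep_eq)
  then show ?thesis
    by (simp add: pmf_conditional_response_law[OF assms(2)])
qed

end

theory Submission
  imports Defs
begin

text \<open>
Item \<open>j\<close> answers \<open>True\<close> exactly when an independent standard normal noise variable does not exceed
\<open>d\<^sub>j + a\<^sub>j \<eta>\<^sub>0 + c\<^sub>j \<eta>\<^sub>g\<close>, where \<open>a\<^sub>j\<close> and \<open>c\<^sub>j\<close> are its main and testlet loading. After division by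
\<open>s\<^sub>j = sqrt (1 + a\<^sub>j\<^sup>2 + c\<^sub>j\<^sup>2)\<close> this says that a standard normal variable lies below the threshold
\<open>t\<^sub>j = d\<^sub>j / s\<^sub>j\<close>. With the standardised loadings \<open>b\<^sub>j = a\<^sub>j / s\<^sub>j\<close> and \<open>w\<^sub>j = c\<^sub>j / s\<^sub>j\<close>, the
variables of two distinct items are correlated by \<open>b\<^sub>i b\<^sub>j\<close>, plus \<open>w\<^sub>i w\<^sub>j\<close> if the items share a testlet.

The response law is equivalent to the thresholds together with these correlations
(\<open>response_law_eq_iff\<close>). It depends on nothing else because jointly Gaussian variables are determined
in law by their covariances. It determines the thresholds through its marginals, and the
correlations because the bivariate normal distribution function is strictly increasing in the
correlation. The map from loadings to \<open>(b\<^sub>j, w\<^sub>j)\<close> is a bijection onto the points of the open unit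
disc, so the theorem reduces to algebra: when do the products above, over distinct items, fix \<open>b\<close> and
\<open>w\<close> up to one sign per column? The sign convention of the parameter space then fixes the signs.

Sufficiency. A vector with three nonzero entries is determined up to sign by the products of its
distinct entries (\<open>rank_one_products_determine_up_to_sign\<close>). If three testlets carry main loadings,
the products across testlets determine \<open>b\<close> in this way. If only two do, they determine \<open>b\<close> up to a
factor \<open>\<kappa>\<close> on one testlet and \<open>1 / \<kappa>\<close> on the other; inside a testlet of \<open>H2_set\<close>, choose rows
\<open>i, j\<close> and \<open>k, l\<close> from the two blocks. The matrix of products of alternative testlet loadings, with rows
\<open>i, j\<close> and columns \<open>k, l\<close>, has rank at most one, while its determinant equals \<open>1 - \<kappa>\<^sup>2\<close> times the two
nonzero minors, so \<open>\<kappa>\<^sup>2 = 1\<close>. Once \<open>b\<close> is known up to sign, three nonzero testlet loadings in every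
testlet determine \<open>w\<close>.

Necessity. Whenever the conditions fail, the standardised loadings can be moved without changing the
correlations. If a testlet has at most one nonzero testlet loading, this one, or an arbitrary one, can be
enlarged; if there are exactly two, one can be enlarged and the other shrunk by the same factor. If no
item has a main loading, one can be introduced. If the main loadings live in one testlet, its pairs
\<open>(b\<^sub>j, w\<^sub>j)\<close> can be rotated. If they live in two testlets, neither of which belongs to \<open>H2_set\<close>, then the
main loadings of one are multiplied, those of the other divided, by a factor near 1, and in each testlet
the testlet loadings can be deformed to compensate (\<open>testlet_deformation\<close>).
\<close>

section \<open>Characteristic functions determine joint laws\<close>

text \<open>
Levy's uniqueness theorem concerns probability measures. After normalisation by the total mass of the
weight it also covers laws of real variables under weighted finite measures.
\<close>

lemma weighted_char_determines_weighted_law: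
  fixes X :: "'a \<Rightarrow> real" and Y :: "'b \<Rightarrow> real" and f :: "'a \<Rightarrow> real" and g :: "'b \<Rightarrow> real"
  assumes M: "finite_measure M" and N: "finite_measure N"
    and X [measurable]: "X \<in> borel_measurable M" and Y [measurable]: "Y \<in> borel_measurable N"
    and f [measurable]: "f \<in> borel_measurable M" and g [measurable]: "g \<in> borel_measurable N"
    and f_bound: "\<And>x. 0 \<le> f x" "\<And>x. f x \<le> C" and g_bound: "\<And>y. 0 \<le> g y" "\<And>y. g y \<le> C"
    and char: "\<And>s. (CLINT x|M. f x * iexp (s * X x)) = (CLINT y|N. g y * iexp (s * Y y))"
    and B [measurable]: "B \<in> sets borel"
  shows "(\<integral>x. f x * indicator B (X x) \<partial>M) = (\<integral>y. g y * indicator B (Y y) \<partial>N)"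
proof -
  interpret M: finite_measure M by fact
  interpret N: finite_measure N by fact
  have intf: "integrable M f"
    by (rule M.integrable_const_bound[where B=C]) (use f_bound in auto)
  have intg: "integrable N g"
    by (rule N.integrable_const_bound[where B=C]) (use g_bound in auto)
  \<comment> \<open>The common total mass; it is the value of both characteristic functions at 0.\<close>
  define m where "m = (\<integral>x. f x \<partial>M)"
  have m': "(\<integral>y. g y \<partial>N) = m"
    using char[of 0] by (simp add: m_def)
  have m0: "m \<ge> 0"
    unfolding m_def by (intro integral_nonneg_AE) (use f_bound in auto)
  have intfB: "integrable M (\<lambda>x. f x * indicator B (X x))"
    by (rule M.integrable_const_bound[where B=C]) (use f_bound in \<open>auto simp: indicator_def intro: order_trans\<close>)
  have intgB: "integrable N (\<lambda>x. g x * indicator B (Y x))"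
    by (rule N.integrable_const_bound[where B=C]) (use g_bound in \<open>auto simp: indicator_def intro: order_trans\<close>)
  show ?thesis
  proof (cases "m = 0")
    case True
    have "(\<integral>x. f x * indicator B (X x) \<partial>M) \<le> m"
      unfolding m_def using intf intfB f_bound by (intro integral_mono) (auto simp: indicator_def)
    moreover have "(\<integral>x. f x * indicator B (X x) \<partial>M) \<ge> 0"
      by (intro integral_nonneg_AE) (use f_bound in auto)
    moreover have "(\<integral>x. g x * indicator B (Y x) \<partial>N) \<le> m"
      unfolding m'[symmetric] using intg intgB g_bound by (intro integral_mono) (auto simp: indicator_def)
    moreover have "(\<integral>x. g x * indicator B (Y x) \<partial>N) \<ge> 0"
      by (intro integral_nonneg_AE) (use g_bound in auto)
    ultimately show ?thesis using True by linarith
  next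
    case False
    then have m: "m > 0" using m0 by simp
    define P where "P = distr (density M (\<lambda>x. f x / m)) borel X"
    define Q where "Q = distr (density N (\<lambda>x. g x / m)) borel Y"
    have P: "real_distribution P"
    proof -
      have "prob_space (density M (\<lambda>x. f x / m))"
      proof (rule prob_spaceI)
        show "emeasure (density M (\<lambda>x. ennreal (f x / m))) (space (density M (\<lambda>x. ennreal (f x / m)))) = 1"
          using m f_bound intf m_def
          by (simp add: emeasure_density nn_integral_eq_integral cong: nn_integral_cong)
      qed
      then interpret prob_space "density M (\<lambda>x. f x / m)" .
      show ?thesis unfolding P_def by (rule real_distribution_distr) simp
    qed
    have Q: "real_distribution Q"
    proof -
      have "prob_space (density N (\<lambda>x. g x / m))"
      proof (rule prob_spaceI)
        show "emeasure (density N (\<lambda>x. ennreal (g x / m))) (space (density N (\<lambda>x. ennreal (g x / m)))) = 1"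
          using m g_bound intg m'
          by (simp add: emeasure_density nn_integral_eq_integral cong: nn_integral_cong)
      qed
      then interpret prob_space "density N (\<lambda>x. g x / m)" .
      show ?thesis unfolding Q_def by (rule real_distribution_distr) simp
    qed
    have charP: "char P s = (CLINT x|M. f x * iexp (s * X x)) / m" for s
    proof -
      have "char P s = (CLINT x|M. (f x / m) *\<^sub>R iexp (s * X x))"
        unfolding char_def P_def using m f_bound
        by (simp add: integral_distr integral_density)
      also have "\<dots> = (CLINT x|M. (f x * iexp (s * X x)) / m)"
        by (intro Bochner_Integration.integral_cong) (auto simp: scaleR_conv_of_real)
      finally show ?thesis by simp
    qed
    have charQ: "char Q s = (CLINT x|N. g x * iexp (s * Y x)) / m" for s
    proof -
      have "char Q s = (CLINT x|N. (g x / m) *\<^sub>R iexp (s * Y x))"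
        unfolding char_def Q_def using m g_bound
        by (simp add: integral_distr integral_density)
      also have "\<dots> = (CLINT x|N. (g x * iexp (s * Y x)) / m)"
        by (intro Bochner_Integration.integral_cong) (auto simp: scaleR_conv_of_real)
      finally show ?thesis by simp
    qed
    have "P = Q"
      by (rule Levy_uniqueness[OF P Q], rule ext) (simp only: charP charQ char)
    then have "(LINT z|P. indicator B z :: real) = (LINT z|Q. indicator B z)" by simp
    then have "(\<integral>x. (f x / m) * indicator B (X x) \<partial>M) = (\<integral>y. (g y / m) * indicator B (Y y) \<partial>N)"
      unfolding P_def Q_def using m f_bound g_bound
      by (simp add: integral_distr integral_density del: integral_indicator Bochner_Integration.integral_indicator)
    then show ?thesis using m by simp
  qed
qed

text \<open>
A complex weight \<open>h\<close> in the unit disc can be recovered from the nonnegative real weights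
\<open>1\<close>, \<open>1 + Re h\<close> and \<open>1 + Im h\<close>. Their characteristic functions are linear combinations of those
belonging to \<open>1\<close>, \<open>h\<close> and the conjugate of \<open>h\<close>, and the last one is the conjugate of the second at the
reflected argument.
\<close>

lemma complex_weighted_char_determines_weighted_law:
  fixes X :: "'a \<Rightarrow> real" and Y :: "'b \<Rightarrow> real" and h :: "'a \<Rightarrow> complex" and k :: "'b \<Rightarrow> complex"
  assumes M: "finite_measure M" and N: "finite_measure N"
    and X [measurable]: "X \<in> borel_measurable M" and Y [measurable]: "Y \<in> borel_measurable N"
    and h [measurable]: "h \<in> borel_measurable M" and k [measurable]: "k \<in> borel_measurable N"
    and h_bound: "\<And>x. norm (h x) \<le> 1" and k_bound: "\<And>y. norm (k y) \<le> 1"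
    and char: "\<And>s. (CLINT x|M. iexp (s * X x)) = (CLINT y|N. iexp (s * Y y))"
    and wchar: "\<And>s. (CLINT x|M. h x * iexp (s * X x)) = (CLINT y|N. k y * iexp (s * Y y))"
    and B [measurable]: "B \<in> sets borel"
  shows "(CLINT x|M. indicator B (X x) *\<^sub>R h x) = (CLINT y|N. indicator B (Y y) *\<^sub>R k y)"
proof -
  interpret M: finite_measure M by fact
  interpret N: finite_measure N by fact
  have iM: "integrable M F" if [measurable]: "F \<in> borel_measurable M" and "\<And>x. norm (F x) \<le> 1"
    for F :: "'a \<Rightarrow> complex"
    by (rule M.integrable_const_bound[where B=1]) (use that in auto)
  have iN: "integrable N F" if [measurable]: "F \<in> borel_measurable N" and "\<And>x. norm (F x) \<le> 1"
    for F :: "'b \<Rightarrow> complex"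
    by (rule N.integrable_const_bound[where B=1]) (use that in auto)
  have [measurable]: "cnj \<in> borel_measurable borel"
    by (intro borel_measurable_continuous_onI continuous_intros)
  have nie: "norm (iexp t) = 1" for t by simp
  have i1: "integrable M (\<lambda>x. iexp (s * X x))" "integrable N (\<lambda>x. iexp (s * Y x))"
    "integrable M (\<lambda>x. h x * iexp (s * X x))" "integrable N (\<lambda>x. k x * iexp (s * Y x))"
    "integrable M (\<lambda>x. cnj (h x) * iexp (s * X x))" "integrable N (\<lambda>x. cnj (k x) * iexp (s * Y x))" for s
    by (rule iM iN; use h_bound k_bound in \<open>simp add: norm_mult nie\<close>)+
  have conj: "(CLINT x|M. cnj (h x) * iexp (s * X x)) = (CLINT y|N. cnj (k y) * iexp (s * Y y))" for s
  proof -
    have "(CLINT x|M. cnj (h x) * iexp (s * X x)) = (CLINT x|M. cnj (h x * iexp ((-s) * X x)))"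
      by (simp add: exp_cnj)
    also have "\<dots> = cnj (CLINT x|M. h x * iexp ((-s) * X x))"
      by (rule integral_bounded_linear'[OF bounded_linear_cnj bounded_linear_cnj]) simp
    also have "\<dots> = cnj (CLINT x|N. k x * iexp ((-s) * Y x))"
      by (simp only: wchar)
    also have "\<dots> = (CLINT x|N. cnj (k x * iexp ((-s) * Y x)))"
      by (rule integral_bounded_linear'[OF bounded_linear_cnj bounded_linear_cnj, symmetric]) simp
    also have "\<dots> = (CLINT y|N. cnj (k y) * iexp (s * Y y))"
      by (simp add: exp_cnj)
    finally show ?thesis .
  qed
  have lin: "(CLINT x|M. (c0 + c1 * h x + c2 * cnj (h x)) * iexp (s * X x)) =
        (CLINT y|N. (c0 + c1 * k y + c2 * cnj (k y)) * iexp (s * Y y))" for c0 c1 c2 s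
    using i1[of s] by (simp add: distrib_right mult.assoc char wchar conj del: of_real_mult)
  have Re_cnj: "complex_of_real (Re z) = z / 2 + cnj z / 2" for z
    by (simp add: complex_eq_iff)
  have Im_cnj: "complex_of_real (1 + Im z) = 1 + (-\<i> / 2) * z + (\<i> / 2) * cnj z" for z
    by (simp add: complex_eq_iff)
  have im_char: "(CLINT x|M. complex_of_real (1 + Im (h x)) * iexp (s * X x)) =
      (CLINT y|N. complex_of_real (1 + Im (k y)) * iexp (s * Y y))" for s
    unfolding Im_cnj by (rule lin)
  have one: "(\<integral>x. 1 * indicator B (X x) \<partial>M) = (\<integral>y. 1 * indicator B (Y y) \<partial>N :: real)"
    by (rule weighted_char_determines_weighted_law[OF M N X Y _ _ _ _ _ _ _ B, where C=1]) (simp_all add: char del: of_real_mult)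
  have bR: "\<bar>Re (h x)\<bar> \<le> 1" "\<bar>Im (h x)\<bar> \<le> 1" "\<bar>Re (k y)\<bar> \<le> 1" "\<bar>Im (k y)\<bar> \<le> 1" for x y
    using h_bound[of x] k_bound[of y] abs_Re_le_cmod abs_Im_le_cmod order_trans by blast+
  have bR': "0 \<le> 1 + Re (h x)" "0 \<le> 1 + Im (h x)" "0 \<le> 1 + Re (k y)" "0 \<le> 1 + Im (k y)"
    "1 + Re (h x) \<le> 2" "1 + Im (h x) \<le> 2" "1 + Re (k y) \<le> 2" "1 + Im (k y) \<le> 2" for x y
    using bR(1)[of x] bR(2)[of x] bR(3)[of y] bR(4)[of y] by linarith+
  have re: "(\<integral>x. (1 + Re (h x)) * indicator B (X x) \<partial>M) = (\<integral>y. (1 + Re (k y)) * indicator B (Y y) \<partial>N)"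
    by (rule weighted_char_determines_weighted_law[OF M N X Y _ _ _ _ _ _ _ B, where C=2])
       (use lin[of 1 "1/2" "1/2"] in \<open>simp_all add: bR' Re_cnj add.assoc del: of_real_mult\<close>)
  have im: "(\<integral>x. (1 + Im (h x)) * indicator B (X x) \<partial>M) = (\<integral>y. (1 + Im (k y)) * indicator B (Y y) \<partial>N)"
    by (rule weighted_char_determines_weighted_law[OF M N X Y _ _ _ _ _ _ _ B, where C=2])
       (simp_all only: im_char, simp_all add: bR')
  have ib: "integrable M (\<lambda>x. indicator B (X x) :: real)" "integrable N (\<lambda>x. indicator B (Y x) :: real)"
    by (rule M.integrable_const_bound[where B=1] N.integrable_const_bound[where B=1]; simp)+
  have ic: "integrable M (\<lambda>x. indicator B (X x) *\<^sub>R h x)" "integrable N (\<lambda>x. indicator B (Y x) *\<^sub>R k x)"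
    by (rule iM iN; use h_bound k_bound in \<open>auto simp: indicator_def\<close>)+
  have ii: "integrable M (\<lambda>x. Re (h x) * indicator B (X x))" "integrable N (\<lambda>x. Re (k x) * indicator B (Y x))"
    "integrable M (\<lambda>x. Im (h x) * indicator B (X x))" "integrable N (\<lambda>x. Im (k x) * indicator B (Y x))"
    using integrable_Re[OF ic(1)] integrable_Re[OF ic(2)] integrable_Im[OF ic(1)] integrable_Im[OF ic(2)]
    by (simp_all add: mult.commute)
  have re': "(\<integral>x. Re (h x) * indicator B (X x) \<partial>M) = (\<integral>y. Re (k y) * indicator B (Y y) \<partial>N)"
    using re one ib ii by (simp add: distrib_right)
  have im': "(\<integral>x. Im (h x) * indicator B (X x) \<partial>M) = (\<integral>y. Im (k y) * indicator B (Y y) \<partial>N)"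
    using im one ib ii by (simp add: distrib_right)
  show ?thesis
    using re' im' integral_Re[OF ic(1)] integral_Re[OF ic(2)] integral_Im[OF ic(1)] integral_Im[OF ic(2)]
    by (simp add: complex_eq_iff mult.commute)
qed

text \<open>
The multivariate uniqueness theorem for characteristic functions, reduced to the real line by induction
on the number of variables. Fixing the frequencies of all variables but one turns their oscillating
factor into a weight of modulus 1, so the preceding lemma replaces the oscillation in the remaining
variable by the indicator of a Borel set. The induction hypothesis then applies to both measures
restricted to that event, which is why the measures vary in the induction.
\<close>

lemma char_determines_joint_law:
  fixes X :: "'k \<Rightarrow> 'a \<Rightarrow> real" and Y :: "'k \<Rightarrow> 'b \<Rightarrow> real"
  assumes "finite K" "finite_measure M" "finite_measure N"
    and "\<And>k. k \<in> K \<Longrightarrow> X k \<in> borel_measurable M" "\<And>k. k \<in> K \<Longrightarrow> Y k \<in> borel_measurable N"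
    and "\<And>\<theta>. (CLINT x|M. iexp (\<Sum>k\<in>K. \<theta> k * X k x)) = (CLINT y|N. iexp (\<Sum>k\<in>K. \<theta> k * Y k y))"
    and "\<And>k. k \<in> K \<Longrightarrow> B k \<in> sets borel"
  shows "measure M {x \<in> space M. \<forall>k\<in>K. X k x \<in> B k} = measure N {y \<in> space N. \<forall>k\<in>K. Y k y \<in> B k}"
  using assms
proof (induction K arbitrary: M N rule: finite_induct)
  case empty
  then have "complex_of_real (measure M (space M)) = complex_of_real (measure N (space N))"
    by simp
  then show ?case by simp
next
  case (insert a K)
  interpret M: finite_measure M by fact
  interpret N: finite_measure N by fact
  have Xa [measurable]: "X a \<in> borel_measurable M" and Ya [measurable]: "Y a \<in> borel_measurable N"
    and Ba [measurable]: "B a \<in> sets borel"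
    using insert.prems by auto
  have XK [measurable]: "\<And>k. k \<in> K \<Longrightarrow> X k \<in> borel_measurable M"
    and YK [measurable]: "\<And>k. k \<in> K \<Longrightarrow> Y k \<in> borel_measurable N"
    and BK [measurable]: "\<And>k. k \<in> K \<Longrightarrow> B k \<in> sets borel"
    using insert.prems by auto
  define M' where "M' = density M (\<lambda>x. ennreal (indicator (B a) (X a x)))"
  define N' where "N' = density N (\<lambda>y. ennreal (indicator (B a) (Y a y)))"
  have nM: "emeasure M' A = emeasure M ({x \<in> space M. X a x \<in> B a} \<inter> A)" if "A \<in> sets M" for A
  proof -
    have "emeasure M' A = (\<integral>\<^sup>+ x. ennreal (indicator (B a) (X a x)) * indicator A x \<partial>M)"
      unfolding M'_def by (intro emeasure_density that) measurable
    also have "\<dots> = (\<integral>\<^sup>+ x. indicator ({x \<in> space M. X a x \<in> B a} \<inter> A) x \<partial>M)"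
      by (intro nn_integral_cong) (auto simp: indicator_def)
    also have "\<dots> = emeasure M ({x \<in> space M. X a x \<in> B a} \<inter> A)"
      using that by (intro nn_integral_indicator) auto
    finally show ?thesis .
  qed
  have nN: "emeasure N' A = emeasure N ({x \<in> space N. Y a x \<in> B a} \<inter> A)" if "A \<in> sets N" for A
  proof -
    have "emeasure N' A = (\<integral>\<^sup>+ x. ennreal (indicator (B a) (Y a x)) * indicator A x \<partial>N)"
      unfolding N'_def by (intro emeasure_density that) measurable
    also have "\<dots> = (\<integral>\<^sup>+ x. indicator ({x \<in> space N. Y a x \<in> B a} \<inter> A) x \<partial>N)"
      by (intro nn_integral_cong) (auto simp: indicator_def)
    also have "\<dots> = emeasure N ({x \<in> space N. Y a x \<in> B a} \<inter> A)"
      using that by (intro nn_integral_indicator) auto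
    finally show ?thesis .
  qed
  have fM': "finite_measure M'"
    by (rule finite_measureI) (use nM[of "space M"] M.emeasure_finite in \<open>auto simp: M'_def\<close>)
  have fN': "finite_measure N'"
    by (rule finite_measureI) (use nN[of "space N"] N.emeasure_finite in \<open>auto simp: N'_def\<close>)
  have ch: "(CLINT x|M. iexp (t * X a x + (\<Sum>k\<in>K. \<theta> k * X k x))) =
      (CLINT y|N. iexp (t * Y a y + (\<Sum>k\<in>K. \<theta> k * Y k y)))" for t \<theta>
  proof -
    have "(\<Sum>k\<in>K. (\<theta>(a := t)) k * f k) = (\<Sum>k\<in>K. \<theta> k * f k)" for f
      using insert.hyps by (intro sum.cong) auto
    then show ?thesis
      using insert.prems(5)[of "\<theta>(a := t)"] insert.hyps by (simp del: fun_upd_apply) (simp add: fun_upd_same)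
  qed
  have "measure M' {x \<in> space M'. \<forall>k\<in>K. X k x \<in> B k} = measure N' {y \<in> space N'. \<forall>k\<in>K. Y k y \<in> B k}"
  proof (rule insert.IH[OF fM' fN'])
    fix \<theta> :: "'k \<Rightarrow> real"
    have "(CLINT x|M. indicator (B a) (X a x) *\<^sub>R iexp (\<Sum>k\<in>K. \<theta> k * X k x)) =
        (CLINT y|N. indicator (B a) (Y a y) *\<^sub>R iexp (\<Sum>k\<in>K. \<theta> k * Y k y))"
    proof (rule complex_weighted_char_determines_weighted_law[OF M.finite_measure_axioms N.finite_measure_axioms Xa Ya _ _ _ _ _ _ Ba])
      show "(CLINT x|M. iexp (s * X a x)) = (CLINT y|N. iexp (s * Y a y))" for s
        using ch[of s "\<lambda>_. 0"] by simp
      show "(CLINT x|M. iexp (\<Sum>k\<in>K. \<theta> k * X k x) * iexp (s * X a x)) =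
          (CLINT y|N. iexp (\<Sum>k\<in>K. \<theta> k * Y k y) * iexp (s * Y a y))" for s
        using ch[of s \<theta>] by (simp add: exp_add distrib_left mult.commute)
    qed simp_all
    then show "(CLINT x|M'. iexp (\<Sum>k\<in>K. \<theta> k * X k x)) = (CLINT y|N'. iexp (\<Sum>k\<in>K. \<theta> k * Y k y))"
      unfolding M'_def N'_def by (simp add: integral_density)
  qed (auto simp: M'_def N'_def)
  moreover have "measure M' {x \<in> space M'. \<forall>k\<in>K. X k x \<in> B k} = measure M {x \<in> space M. \<forall>k\<in>insert a K. X k x \<in> B k}"
  proof -
    have "{x \<in> space M. \<forall>k\<in>K. X k x \<in> B k} \<in> sets M"
      using \<open>finite K\<close> by measurable
    then show ?thesis
      using nM[of "{x \<in> space M. \<forall>k\<in>K. X k x \<in> B k}"]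
      by (auto simp: measure_def M'_def intro!: arg_cong[where f="\<lambda>S. enn2real (emeasure M S)"])
  qed
  moreover have "measure N' {x \<in> space N'. \<forall>k\<in>K. Y k x \<in> B k} = measure N {x \<in> space N. \<forall>k\<in>insert a K. Y k x \<in> B k}"
  proof -
    have "{x \<in> space N. \<forall>k\<in>K. Y k x \<in> B k} \<in> sets N"
      using \<open>finite K\<close> by measurable
    then show ?thesis
      using nN[of "{x \<in> space N. \<forall>k\<in>K. Y k x \<in> B k}"]
      by (auto simp: measure_def N'_def intro!: arg_cong[where f="\<lambda>S. enn2real (emeasure N S)"])
  qed
  ultimately show ?case by simp
qed

section \<open>Linear forms in independent normal variables\<close>

definition std_gauss :: "'i set \<Rightarrow> ('i \<Rightarrow> real) measure" where
  "std_gauss I = PiM I (\<lambda>_. std_normal_distribution)"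

lemma prob_space_std_gauss: "prob_space (std_gauss I)"
  unfolding std_gauss_def by (intro prob_space_PiM prob_space_normal_density) simp

lemma measurable_std_gauss_component [measurable]:
  "i \<in> I \<Longrightarrow> (\<lambda>x. x i) \<in> borel_measurable (std_gauss I)"
  using measurable_component_singleton[of i I "\<lambda>_. std_normal_distribution"]
  by (simp add: std_gauss_def measurable_cong_sets[OF refl sets_density])

lemma product_sigma_finite_std_normal: "product_sigma_finite (\<lambda>_. std_normal_distribution)"
  by (simp add: product_sigma_finite_def prob_space_imp_sigma_finite prob_space_normal_density)

lemma char_linear_form:
  assumes "finite I"
  shows "(CLINT x|std_gauss I. iexp (\<Sum>i\<in>I. u i * x i)) = exp (- (\<Sum>i\<in>I. (u i)\<^sup>2) / 2)"
proof -
  interpret product_sigma_finite "\<lambda>_. std_normal_distribution" by (rule product_sigma_finite_std_normal)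
  interpret N: prob_space std_normal_distribution by (rule prob_space_normal_density) simp
  have "(CLINT x|std_gauss I. iexp (\<Sum>i\<in>I. u i * x i)) =
      (CLINT x|std_gauss I. (\<Prod>i\<in>I. iexp (u i * x i)))"
    using assms by (simp add: sum_distrib_left exp_sum)
  also have "\<dots> = (\<Prod>i\<in>I. CLINT x|std_normal_distribution. iexp (u i * x))"
    unfolding std_gauss_def
    by (intro product_integral_prod assms N.integrable_const_bound[where B=1]) auto
  also have "\<dots> = (\<Prod>i\<in>I. char std_normal_distribution (u i))"
    by (simp add: char_def)
  also have "\<dots> = of_real (\<Prod>i\<in>I. exp (- ((u i)\<^sup>2) / 2))"
    by (simp add: char_std_normal_distribution del: of_real_exp)
  also have "\<dots> = exp (- (\<Sum>i\<in>I. (u i)\<^sup>2) / 2)"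
    using assms by (simp add: exp_sum[symmetric] sum_negf sum_divide_distrib del: of_real_exp of_real_prod)
  finally show ?thesis .
qed

text \<open>
The characteristic function of a family of linear forms in independent standard normal variables is
the exponential of a quadratic form whose coefficients are the covariances. The two index sets may
differ, so that a complicated family can be compared with a simple representative.
\<close>

lemma gaussian_joint_law_determined_by_covariance:
  fixes c :: "'k \<Rightarrow> 'i \<Rightarrow> real" and c' :: "'k \<Rightarrow> 'j \<Rightarrow> real"
  assumes "finite K" "finite I" "finite I'"
    and cov: "\<And>k l. k \<in> K \<Longrightarrow> l \<in> K \<Longrightarrow> (\<Sum>i\<in>I. c k i * c l i) = (\<Sum>i\<in>I'. c' k i * c' l i)"
    and B: "\<And>k. k \<in> K \<Longrightarrow> B k \<in> sets borel"
  shows "measure (std_gauss I) {x \<in> space (std_gauss I). \<forall>k\<in>K. (\<Sum>i\<in>I. c k i * x i) \<in> B k} =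
         measure (std_gauss I') {x \<in> space (std_gauss I'). \<forall>k\<in>K. (\<Sum>i\<in>I'. c' k i * x i) \<in> B k}"
proof (rule char_determines_joint_law[OF \<open>finite K\<close>])
  fix \<theta> :: "'k \<Rightarrow> real"
  have form: "(CLINT x|std_gauss H. iexp (\<Sum>k\<in>K. \<theta> k * (\<Sum>i\<in>H. f k i * x i))) =
      exp (- (\<Sum>k\<in>K. \<Sum>l\<in>K. \<theta> k * \<theta> l * (\<Sum>i\<in>H. f k i * f l i)) / 2)"
    if "finite H" for H :: "'h set" and f
  proof -
    have "(\<Sum>k\<in>K. \<theta> k * (\<Sum>i\<in>H. f k i * x i)) = (\<Sum>i\<in>H. (\<Sum>k\<in>K. \<theta> k * f k i) * x i)" for x
      unfolding sum_distrib_left sum_distrib_right by (subst sum.swap) (simp add: mult.assoc)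
    moreover have "(\<Sum>i\<in>H. (\<Sum>k\<in>K. \<theta> k * f k i)\<^sup>2) = (\<Sum>k\<in>K. \<Sum>l\<in>K. \<theta> k * \<theta> l * (\<Sum>i\<in>H. f k i * f l i))"
    proof -
      have "(\<Sum>i\<in>H. (\<Sum>k\<in>K. \<theta> k * f k i)\<^sup>2) = (\<Sum>i\<in>H. \<Sum>k\<in>K. \<Sum>l\<in>K. \<theta> k * \<theta> l * (f k i * f l i))"
        by (simp add: power2_eq_square sum_product algebra_simps)
      also have "\<dots> = (\<Sum>k\<in>K. \<Sum>i\<in>H. \<Sum>l\<in>K. \<theta> k * \<theta> l * (f k i * f l i))"
        by (rule sum.swap)
      also have "\<dots> = (\<Sum>k\<in>K. \<Sum>l\<in>K. \<Sum>i\<in>H. \<theta> k * \<theta> l * (f k i * f l i))"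
        by (intro sum.cong refl sum.swap)
      finally show ?thesis by (simp add: sum_distrib_left)
    qed
    ultimately show ?thesis using char_linear_form[OF that, of "\<lambda>i. \<Sum>k\<in>K. \<theta> k * f k i"] by simp
  qed
  show "(CLINT x|std_gauss I. iexp (\<Sum>k\<in>K. \<theta> k * (\<Sum>i\<in>I. c k i * x i))) =
        (CLINT x|std_gauss I'. iexp (\<Sum>k\<in>K. \<theta> k * (\<Sum>i\<in>I'. c' k i * x i)))"
    unfolding form[OF assms(2)] form[OF assms(3)] using cov by simp
qed (use B prob_space.finite_measure[OF prob_space_std_gauss] in auto)

section \<open>Normal distribution functions in one and two dimensions\<close>

lemma Phi_altdef: "Phi x = measure std_normal_distribution {..x}"
  by (simp add: Phi_def cdf_def)

text \<open>
Increments of \<open>Phi\<close> are masses of intervals; this makes positivity of the density available both for strict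
monotonicity of \<open>Phi\<close> and for the positivity of integrals below.
\<close>

lemma Phi_diff:
  assumes "x \<le> y"
  shows "Phi y - Phi x = measure std_normal_distribution {x<..y}"
proof -
  interpret N: prob_space std_normal_distribution by (rule prob_space_normal_density) simp
  have "measure std_normal_distribution ({..y} - {..x}) = Phi y - Phi x"
    unfolding Phi_altdef using assms by (intro N.finite_measure_Diff) auto
  moreover have "{..y} - {..x} = {x<..y}" by auto
  ultimately show ?thesis by simp
qed

lemma Phi_strict_mono: "x < y \<Longrightarrow> Phi x < Phi y"
proof -
  assume xy: "x < y"
  interpret N: prob_space std_normal_distribution by (rule prob_space_normal_density) simp
  have "Phi y - Phi x = measure std_normal_distribution {x<..y}"
    using xy by (simp add: Phi_diff)
  moreover have "measure std_normal_distribution {x<..y} \<noteq> 0"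
  proof
    assume "measure std_normal_distribution {x<..y} = 0"
    then have "emeasure std_normal_distribution {x<..y} = 0"
      by (simp add: N.emeasure_eq_measure)
    then have "AE z in lborel. z \<in> {x<..y} \<longrightarrow> ennreal (std_normal_density z) \<le> 0"
      by (subst (asm) emeasure_density) (auto simp: nn_integral_0_iff_AE indicator_def)
    then have "AE z in lborel. z \<notin> {x<..y}"
      by eventually_elim (use normal_density_pos[of 1 0] in \<open>simp add: ennreal_eq_0_iff, metis not_le\<close>)
    then have "emeasure lborel {x<..y} = 0"
      by (subst (asm) AE_iff_measurable[OF _ refl]) (auto simp: greaterThanAtMost_def greaterThan_def atMost_def Collect_conj_eq)
    then show False using xy by simp
  qed
  ultimately show ?thesis by (smt (verit) measure_nonneg)
qed

lemma inj_Phi: "Phi x = Phi y \<longleftrightarrow> x = y"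
  by (metis Phi_strict_mono not_less_iff_gr_or_eq)

text \<open>
By comparison with a single coordinate.
\<close>

lemma gaussian_marginal:
  assumes "finite I" and var: "(\<Sum>i\<in>I. (c i)\<^sup>2) = 1"
  shows "measure (std_gauss I) {x \<in> space (std_gauss I). (\<Sum>i\<in>I. c i * x i) \<le> t} = Phi t"
proof -
  interpret product_sigma_finite "\<lambda>_. std_normal_distribution" by (rule product_sigma_finite_std_normal)
  have "measure (std_gauss I) {x \<in> space (std_gauss I). \<forall>k\<in>{()}. (\<Sum>i\<in>I. c i * x i) \<in> {..t}} =
      measure (std_gauss {()}) {x \<in> space (std_gauss {()}). \<forall>k\<in>{()}. (\<Sum>i\<in>{()}. 1 * x i) \<in> {..t}}"
    using assms by (intro gaussian_joint_law_determined_by_covariance) (auto simp: power2_eq_square)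
  also have "\<dots> = measure (std_gauss {()}) ((\<lambda>x. x ()) -` {..t} \<inter> space (std_gauss {()}))"
    by (rule arg_cong[where f="measure (std_gauss {()})"]) auto
  also have "\<dots> = measure (distr (std_gauss {()}) std_normal_distribution (\<lambda>x. x ())) {..t}"
    unfolding std_gauss_def
  proof (rule measure_distr[symmetric])
    show "(\<lambda>x. x ()) \<in> PiM {()} (\<lambda>_. std_normal_distribution) \<rightarrow>\<^sub>M std_normal_distribution"
      by (rule measurable_component_singleton) simp
    show "{..t} \<in> sets std_normal_distribution"
      by (simp only: sets_density) simp
  qed
  also have "distr (std_gauss {()}) std_normal_distribution (\<lambda>x. x ()) = std_normal_distribution"
    unfolding std_gauss_def by (rule distr_singleton)
  finally show ?thesis by (simp add: Phi_altdef)
qed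

text \<open>
The distribution function at \<open>(a, b)\<close> of a standard normal pair with correlation \<open>r\<close>, obtained by
conditioning on the first coordinate \<open>x\<close>: the second one is then normal with mean \<open>r x\<close> and variance
\<open>1 - r\<^sup>2\<close>.
\<close>

definition bivariate_cdf :: "real \<Rightarrow> real \<Rightarrow> real \<Rightarrow> real" where
  "bivariate_cdf r a b =
     (\<integral>x. indicator {..a} x * Phi ((b - r * x) / sqrt (1 - r\<^sup>2)) \<partial>std_normal_distribution)"

text \<open>
Fubini for the pair \<open>(x, r x + s y)\<close> with independent coordinates. The set \<open>S\<close> will be a half line, giving
\<open>bivariate_cdf\<close>, or the whole line, giving the marginal of the second variable.
\<close>

lemma measure_std_gauss_pair:
  assumes s: "s > 0" and S [measurable]: "S \<in> sets borel"
  shows "measure (std_gauss {0, 1::nat}) {x \<in> space (std_gauss {0, 1}). x 0 \<in> S \<and> r * x 0 + s * x 1 \<le> b} =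
    (\<integral>x. indicator S x * Phi ((b - r * x) / s) \<partial>std_normal_distribution)"
proof -
  interpret product_sigma_finite "\<lambda>_. std_normal_distribution" by (rule product_sigma_finite_std_normal)
  interpret N: prob_space std_normal_distribution by (rule prob_space_normal_density) simp
  interpret G: prob_space "std_gauss {0, 1::nat}" by (rule prob_space_std_gauss)
  define f :: "(nat \<Rightarrow> real) \<Rightarrow> real"
    where "f x = indicator S (x 0) * indicator {..b} (r * x 0 + s * x 1)" for x
  have [measurable]: "(\<lambda>x. x 0) \<in> borel_measurable (std_gauss {0, 1::nat})"
    "(\<lambda>x. x 1) \<in> borel_measurable (std_gauss {0, 1::nat})"
    by (simp_all add: measurable_std_gauss_component)
  then have f_meas: "f \<in> borel_measurable (std_gauss {0, 1::nat})"
    unfolding f_def by measurable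
  have f_int: "integrable (PiM (insert 1 {0::nat}) (\<lambda>_. std_normal_distribution)) f"
  proof -
    have "integrable (std_gauss {0, 1::nat}) f"
      by (rule G.integrable_const_bound[where B=1, OF AE_I2 f_meas]) (simp add: f_def indicator_def)
    moreover have "insert 1 {0::nat} = {0, 1}" by auto
    ultimately show ?thesis by (simp only: std_gauss_def)
  qed
  have inner: "(\<integral>y. indicator S z * indicator {..b} (r * z + s * y) \<partial>std_normal_distribution) =
      indicator S z * Phi ((b - r * z) / s)" for z :: real
  proof -
    have "indicator {..b} (r * z + s * y) = (indicator {..(b - r * z) / s} y :: real)" for y
      using s by (simp add: indicator_def pos_le_divide_eq algebra_simps)
    then show ?thesis by (simp add: Phi_altdef)
  qed
  have "measure (std_gauss {0, 1::nat}) {x \<in> space (std_gauss {0, 1}). x 0 \<in> S \<and> r * x 0 + s * x 1 \<le> b} =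
      (\<integral>x. indicator {x \<in> space (std_gauss {0, 1}). x 0 \<in> S \<and> r * x 0 + s * x 1 \<le> b} x \<partial>std_gauss {0, 1::nat})"
    by simp
  also have "\<dots> = (\<integral>x. f x \<partial>std_gauss {0, 1::nat})"
    by (intro Bochner_Integration.integral_cong) (auto simp: f_def indicator_def)
  also have "\<dots> = (\<integral>x. f x \<partial>PiM (insert 1 {0::nat}) (\<lambda>_. std_normal_distribution))"
  proof -
    have "insert 1 {0::nat} = {0, 1}" by auto
    then show ?thesis by (simp only: std_gauss_def)
  qed
  also have "\<dots> = (\<integral>x. (\<integral>y. f (x(1 := y)) \<partial>std_normal_distribution) \<partial>PiM {0::nat} (\<lambda>_. std_normal_distribution))"
    by (rule product_integral_insert[OF _ _ f_int]) auto
  also have "\<dots> = (\<integral>x. indicator S (x 0) * Phi ((b - r * x 0) / s) \<partial>PiM {0::nat} (\<lambda>_. std_normal_distribution))"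
    by (simp only: f_def fun_upd_same fun_upd_other[OF zero_neq_one] inner)
  also have "\<dots> = (\<integral>x. indicator S x * Phi ((b - r * x) / s) \<partial>std_normal_distribution)"
    by (rule product_integral_singleton) simp
  finally show ?thesis .
qed

text \<open>
By comparison with the representative \<open>(x, r x + sqrt (1 - r\<^sup>2) y)\<close> of all standard normal pairs with
correlation \<open>r\<close>.
\<close>

lemma gaussian_bivariate:
  assumes "finite I" and var: "(\<Sum>i\<in>I. (c i)\<^sup>2) = 1" "(\<Sum>i\<in>I. (e i)\<^sup>2) = 1"
    and cov: "(\<Sum>i\<in>I. c i * e i) = r" and r: "\<bar>r\<bar> < 1"
  shows "measure (std_gauss I) {x \<in> space (std_gauss I). (\<Sum>i\<in>I. c i * x i) \<le> a \<and> (\<Sum>i\<in>I. e i * x i) \<le> b}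
    = bivariate_cdf r a b"
proof -
  define C where "C k = (if k then c else e)" for k
  define C' where "C' k i = (if k then (if i = 0 then 1 else 0) else (if i = 0 then r else sqrt (1 - r\<^sup>2)))"
    for k :: bool and i :: nat
  have r2: "r\<^sup>2 < 1" using r by (simp add: abs_square_less_1)
  have "measure (std_gauss I) {x \<in> space (std_gauss I). \<forall>k\<in>UNIV. (\<Sum>i\<in>I. C k i * x i) \<in> {..if k then a else b}} =
      measure (std_gauss {0, 1}) {x \<in> space (std_gauss {0, 1}). \<forall>k\<in>UNIV. (\<Sum>i\<in>{0, 1}. C' k i * x i) \<in> {..if k then a else b}}"
  proof (rule gaussian_joint_law_determined_by_covariance)
    have "(\<Sum>i\<in>I. e i * c i) = r" using cov by (simp add: mult.commute)
    then show "(\<Sum>i\<in>I. C k i * C l i) = (\<Sum>i\<in>{0, 1}. C' k i * C' l i)" for k l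
      using var cov r2 by (cases k; cases l) (simp_all add: C_def C'_def flip: power2_eq_square)
  qed (use assms in auto)
  also have "\<dots> = measure (std_gauss {0, 1::nat}) {x \<in> space (std_gauss {0, 1}). x 0 \<in> {..a} \<and> r * x 0 + sqrt (1 - r\<^sup>2) * x 1 \<le> b}"
    by (intro arg_cong[where f="measure _"]) (auto simp: C'_def all_bool_eq)
  also have "\<dots> = bivariate_cdf r a b"
    unfolding bivariate_cdf_def using r2 by (intro measure_std_gauss_pair) auto
  finally show ?thesis by (simp add: C_def all_bool_eq)
qed

lemma integral_std_normal_pos:
  fixes h :: "real \<Rightarrow> real"
  assumes int: "integrable std_normal_distribution h" and nonneg: "\<And>x. 0 \<le> h x"
    and pos: "\<And>x. p < x \<Longrightarrow> x \<le> q \<Longrightarrow> 0 < h x" and pq: "p < q"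
  shows "0 < (\<integral>x. h x \<partial>std_normal_distribution)"
proof (rule ccontr)
  interpret N: prob_space std_normal_distribution by (rule prob_space_normal_density) simp
  assume "\<not> ?thesis"
  moreover have "0 \<le> (\<integral>x. h x \<partial>std_normal_distribution)"
    by (rule integral_nonneg_AE) (simp add: nonneg)
  ultimately have "(\<integral>x. h x \<partial>std_normal_distribution) = 0"
    by linarith
  then have "AE x in std_normal_distribution. h x = 0"
    unfolding integral_nonneg_eq_0_iff_AE[OF int AE_I2[OF nonneg]] .
  then have "AE x in std_normal_distribution. x \<notin> {p<..q}"
    by eventually_elim (use pos in force)
  moreover have "{x \<in> space std_normal_distribution. \<not> x \<notin> {p<..q}} = {p<..q}" by auto
  ultimately have "measure std_normal_distribution {p<..q} = 0"
    by (simp add: AE_iff_measurable[OF _ refl] measure_def)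
  moreover have "Phi q - Phi p = measure std_normal_distribution {p<..q}"
    using pq by (simp add: Phi_diff)
  ultimately show False using Phi_strict_mono[OF pq] by simp
qed

text \<open>
A single crossing argument. For two correlations, the arguments of \<open>Phi\<close> are affine functions of \<open>x\<close>, and
the one for the larger correlation falls more steeply, since \<open>r / sqrt (1 - r\<^sup>2)\<close> increases with \<open>r\<close>.
So the difference \<open>g\<close> of the two integrands is positive up to some \<open>z\<close> and negative beyond it. Its
integral over the whole line vanishes, because both pairs have the same second marginal. Hence its
integral over a half line up to \<open>a\<close> is positive: directly if \<open>a \<le> z\<close>, and otherwise as minus the
integral of a negative function over the complementary half line.
\<close>

lemma bivariate_cdf_strict_mono:
  assumes r: "-1 < r" "r < r'" "r' < 1"
  shows "bivariate_cdf r a b < bivariate_cdf r' a b"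
proof -
  interpret N: prob_space std_normal_distribution by (rule prob_space_normal_density) simp
  define s s' where "s = sqrt (1 - r\<^sup>2)" and "s' = sqrt (1 - r'\<^sup>2)"
  have r2: "r\<^sup>2 < 1" "r'\<^sup>2 < 1" using r by (simp_all add: abs_square_less_1)
  then have s: "s > 0" "s' > 0" by (simp_all add: s_def s'_def)
  define g where "g x = Phi ((b - r' * x) / s') - Phi ((b - r * x) / s)" for x
  have int: "integrable std_normal_distribution (\<lambda>x. indicator S x * Phi ((b - q * x) / v))"
    if [measurable]: "S \<in> sets borel" for S q v
    using Phi_nonneg Phi_le_1
    by (intro N.integrable_const_bound[where B=1]) (auto simp: indicator_def)
  have intg: "integrable std_normal_distribution (\<lambda>x. indicator S x * g x)" if "S \<in> sets borel" for S
    using int[OF that] by (simp add: g_def right_diff_distrib)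
  have total: "(\<integral>x. indicator UNIV x * Phi ((b - q * x) / sqrt (1 - q\<^sup>2)) \<partial>std_normal_distribution) = Phi b"
    if "q\<^sup>2 < 1" for q
  proof -
    have "(\<integral>x. indicator UNIV x * Phi ((b - q * x) / sqrt (1 - q\<^sup>2)) \<partial>std_normal_distribution) =
      measure (std_gauss {0, 1::nat}) {x \<in> space (std_gauss {0, 1}). x 0 \<in> UNIV \<and> q * x 0 + sqrt (1 - q\<^sup>2) * x 1 \<le> b}"
      using that by (intro measure_std_gauss_pair[symmetric]) auto
    also have "\<dots> = measure (std_gauss {0, 1::nat}) {x \<in> space (std_gauss {0, 1}).
        (\<Sum>i\<in>{0, 1}. (if i = 0 then q else sqrt (1 - q\<^sup>2)) * x i) \<le> b}"
      by (intro arg_cong[where f="measure _"]) auto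
    also have "\<dots> = Phi b"
      using that by (intro gaussian_marginal) auto
    finally show ?thesis .
  qed
  have g_total: "(\<integral>x. indicator UNIV x * g x \<partial>std_normal_distribution) = 0"
    using int[of UNIV] total[OF r2(1)] total[OF r2(2)]
    by (simp add: g_def right_diff_distrib s_def s'_def)
  define \<kappa> where "\<kappa> = r' / s' - r / s"
  have \<kappa>: "\<kappa> > 0"
  proof -
    have "r / s < r' / s'"
    proof (cases "r < 0")
      case True
      show ?thesis
      proof (cases "r' \<ge> 0")
        case True
        have "r / s < 0" using \<open>r < 0\<close> s by (simp add: divide_neg_pos)
        also have "0 \<le> r' / s'" using True s by simp
        finally show ?thesis .
      next
        case False
        then have "(- r')\<^sup>2 < (- r)\<^sup>2" using r by (intro power_strict_mono) auto
        then have "r'\<^sup>2 < r\<^sup>2" by simp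
        then have "s < s'" by (simp add: s_def s'_def)
        then have "(- r') / s' < (- r) / s"
          using False r s by (intro frac_less) auto
        then show ?thesis by simp
      qed
    next
      case False
      then have "r\<^sup>2 < r'\<^sup>2" using r by (intro power_strict_mono) auto
      then have "s' < s" by (simp add: s_def s'_def)
      then show ?thesis using False r s by (intro frac_less) auto
    qed
    then show ?thesis by (simp add: \<kappa>_def)
  qed
  \<comment> \<open>The point at which the two affine functions meet.\<close>
  define z where "z = (b / s' - b / s) / \<kappa>"
  have lin: "(b - r' * x) / s' - (b - r * x) / s = \<kappa> * (z - x)" for x
  proof -
    have "\<kappa> * z = b / s' - b / s" using \<kappa> by (simp add: z_def)
    then show ?thesis by (simp add: right_diff_distrib) (simp add: \<kappa>_def diff_divide_distrib left_diff_distrib)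
  qed
  have g_pos: "g x > 0" if "x < z" for x
  proof -
    have "\<kappa> * (z - x) > 0" using that \<kappa> by simp
    then show ?thesis using Phi_strict_mono[of "(b - r * x) / s" "(b - r' * x) / s'"] lin[of x] by (simp add: g_def)
  qed
  have g_neg: "g x < 0" if "z < x" for x
  proof -
    have "\<kappa> * (z - x) < 0" using that \<kappa> by (simp add: mult_pos_neg)
    then show ?thesis using Phi_strict_mono[of "(b - r' * x) / s'" "(b - r * x) / s"] lin[of x] by (simp add: g_def)
  qed
  have g_zero: "g z = 0"
    using lin[of z] by (simp add: g_def)
  have "0 < (\<integral>x. indicator {..a} x * g x \<partial>std_normal_distribution)"
  proof (cases "a \<le> z")
    case True
    show ?thesis
    proof (rule integral_std_normal_pos[OF intg, where p = "a - 2" and q = "a - 1"])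
      show "0 \<le> indicator {..a} x * g x" for x
        using g_pos[of x] g_zero True by (cases "x < z"; cases "x = z") (auto simp: indicator_def)
    qed (use g_pos True in auto)
  next
    case False
    have "0 < (\<integral>x. - (indicator {a<..} x * g x) \<partial>std_normal_distribution)"
    proof (rule integral_std_normal_pos[where p = "a + 1" and q = "a + 2"])
      show "integrable std_normal_distribution (\<lambda>x. - (indicator {a<..} x * g x))"
        using intg[of "{a<..}"] by simp
      show "0 \<le> - (indicator {a<..} x * g x)" for x
        using g_neg[of x] False by (auto simp: indicator_def)
    qed (use g_neg False in auto)
    moreover have "(\<integral>x. indicator UNIV x * g x \<partial>std_normal_distribution) =
        (\<integral>x. indicator {..a} x * g x + indicator {a<..} x * g x \<partial>std_normal_distribution)"
      by (intro Bochner_Integration.integral_cong) (auto simp: indicator_def)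
    ultimately show ?thesis
      using g_total intg[of "{..a}"] intg[of "{a<..}"] by simp
  qed
  also have "\<dots> = bivariate_cdf r' a b - bivariate_cdf r a b"
    using int[of "{..a}"] by (simp add: bivariate_cdf_def g_def right_diff_distrib s_def s'_def)
  finally show ?thesis by simp
qed

lemma bivariate_cdf_inj:
  assumes "\<bar>r\<bar> < 1" "\<bar>r'\<bar> < 1" "bivariate_cdf r a b = bivariate_cdf r' a b"
  shows "r = r'"
proof (cases r r' rule: linorder_cases)
  case less
  then show ?thesis using bivariate_cdf_strict_mono[of r r' a b] assms by linarith
next
  case greater
  then show ?thesis using bivariate_cdf_strict_mono[of r' r a b] assms by linarith
qed

section \<open>The response law in terms of thresholds and correlations\<close>

definition item_sd :: "(nat \<Rightarrow> nat) \<Rightarrow> real mat \<Rightarrow> nat \<Rightarrow> real" where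
  "item_sd testlet A j = sqrt (1 + (A $$ (j, 0))\<^sup>2 + (A $$ (j, testlet j))\<^sup>2)"

definition std_main :: "(nat \<Rightarrow> nat) \<Rightarrow> real mat \<Rightarrow> nat \<Rightarrow> real" where
  "std_main testlet A j = A $$ (j, 0) / item_sd testlet A j"

definition std_testlet :: "(nat \<Rightarrow> nat) \<Rightarrow> real mat \<Rightarrow> nat \<Rightarrow> real" where
  "std_testlet testlet A j = A $$ (j, testlet j) / item_sd testlet A j"

definition std_threshold :: "(nat \<Rightarrow> nat) \<Rightarrow> real mat \<Rightarrow> real vec \<Rightarrow> nat \<Rightarrow> real" where
  "std_threshold testlet A d j = d $ j / item_sd testlet A j"

text \<open>
For \<open>i \<noteq> j\<close> this is the correlation of the standardised latent variables of two items. At \<open>i = j\<close> the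
contribution of the noise is absent, so it is not 1 there.
\<close>

definition item_corr :: "(nat \<Rightarrow> nat) \<Rightarrow> (nat \<Rightarrow> real) \<Rightarrow> (nat \<Rightarrow> real) \<Rightarrow> nat \<Rightarrow> nat \<Rightarrow> real" where
  "item_corr testlet b w i j = b i * b j + (if testlet i = testlet j then w i * w j else 0)"

lemma item_sd_pos: "item_sd testlet A j > 0"
  unfolding item_sd_def by (simp add: add_pos_nonneg)

lemma item_sd_squared: "(item_sd testlet A j)\<^sup>2 = 1 + (A $$ (j, 0))\<^sup>2 + (A $$ (j, testlet j))\<^sup>2"
  unfolding item_sd_def by simp

text \<open>
The three summands are the variances that the noise, the main factor and the testlet factor contribute
to the standardised latent variable.
\<close>

lemma std_norm: "1 / (item_sd testlet A j)\<^sup>2 + (std_main testlet A j)\<^sup>2 + (std_testlet testlet A j)\<^sup>2 = 1"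
proof -
  have "1 / (item_sd testlet A j)\<^sup>2 + (std_main testlet A j)\<^sup>2 + (std_testlet testlet A j)\<^sup>2 =
      (1 + (A $$ (j, 0))\<^sup>2 + (A $$ (j, testlet j))\<^sup>2) / (item_sd testlet A j)\<^sup>2"
    by (simp add: std_main_def std_testlet_def power_divide add_divide_distrib)
  also have "\<dots> = 1"
    using item_sd_pos[of testlet A j] by (simp add: item_sd_squared[symmetric])
  finally show ?thesis .
qed

lemma std_norm_less_1: "(std_main testlet A j)\<^sup>2 + (std_testlet testlet A j)\<^sup>2 < 1"
proof -
  have "1 / (item_sd testlet A j)\<^sup>2 > 0" using item_sd_pos[of testlet A j] by simp
  then show ?thesis using std_norm[of testlet A j] by linarith
qed

lemma abs_item_corr_less_1:
  assumes "(b i)\<^sup>2 + (w i)\<^sup>2 < 1" "(b j)\<^sup>2 + (w j)\<^sup>2 < 1"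
  shows "\<bar>item_corr testlet b w i j\<bar> < 1"
proof -
  have ab: "\<bar>x * y\<bar> \<le> (x\<^sup>2 + y\<^sup>2) / 2" for x y :: real
    using sum_squares_ge_zero[of "\<bar>x\<bar> - \<bar>y\<bar>" 0] by (simp add: power2_eq_square algebra_simps abs_mult)
  have "\<bar>item_corr testlet b w i j\<bar> \<le> \<bar>b i * b j\<bar> + \<bar>w i * w j\<bar>"
    unfolding item_corr_def by auto
  also have "\<dots> \<le> ((b i)\<^sup>2 + (b j)\<^sup>2) / 2 + ((w i)\<^sup>2 + (w j)\<^sup>2) / 2"
    by (intro add_mono ab)
  also have "\<dots> = (((b i)\<^sup>2 + (w i)\<^sup>2) + ((b j)\<^sup>2 + (w j)\<^sup>2)) / 2"
    by (simp add: add_divide_distrib)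
  also have "\<dots> < 1" using assms by simp
  finally show ?thesis .
qed

text \<open>
The coordinates \<open>0, ..., G\<close> are the factors; the coordinate \<open>Suc G + j\<close> is the noise of item \<open>j\<close>.
\<close>

definition latent_index :: "nat \<Rightarrow> nat \<Rightarrow> nat set" where
  "latent_index J G = {0..G} \<union> {Suc G..<Suc G + J}"

text \<open>
The coefficients of the standardised latent variable of item \<open>j\<close>. The factors enter with a negative
sign because the answer is \<open>True\<close> when the noise is at most the predictor. The three cases may be
added up, as the coordinates concerned are distinct.
\<close>

definition latent_coeff :: "nat \<Rightarrow> (nat \<Rightarrow> nat) \<Rightarrow> real mat \<Rightarrow> nat \<Rightarrow> nat \<Rightarrow> real" where
  "latent_coeff G testlet A j i =
     (if i = Suc G + j then 1 / item_sd testlet A j else 0)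
     - (if i = 0 then std_main testlet A j else 0) - (if i = testlet j then std_testlet testlet A j else 0)"

lemma testlet_range:
  assumes "testlet_assignment J G testlet" "j < J"
  shows "1 \<le> testlet j" "testlet j \<le> G"
  using assms unfolding testlet_assignment_def by auto

lemma latent_form:
  assumes "testlet_assignment J G testlet" "j < J"
  shows "(\<Sum>i\<in>latent_index J G. latent_coeff G testlet A j i * x i) =
    x (Suc G + j) / item_sd testlet A j - std_main testlet A j * x 0 - std_testlet testlet A j * x (testlet j)"
proof -
  have "finite (latent_index J G)" "Suc G + j \<in> latent_index J G" "0 \<in> latent_index J G" "testlet j \<in> latent_index J G"
    using assms testlet_range[OF assms] by (auto simp: latent_index_def)
  then show ?thesis
    by (simp add: latent_coeff_def left_diff_distrib sum_subtractf if_distrib[of "\<lambda>z. z * _"] sum.delta cong: if_cong)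
qed

text \<open>
The covariance is the latent form of item \<open>i\<close> evaluated at the coefficient vector of item \<open>j\<close>.
\<close>

lemma latent_cov:
  assumes "testlet_assignment J G testlet" "i < J" "j < J"
  shows "(\<Sum>k\<in>latent_index J G. latent_coeff G testlet A i k * latent_coeff G testlet A j k) =
    (if i = j then 1 else item_corr testlet (std_main testlet A) (std_testlet testlet A) i j)"
  using testlet_range[OF assms(1,2)] testlet_range[OF assms(1,3)] std_norm[of testlet A j]
  unfolding latent_form[OF assms(1,2)]
  by (auto simp: latent_coeff_def item_corr_def power2_eq_square)

lemma latent_le_threshold_iff:
  assumes "testlet_assignment J G testlet" "j < J"
  shows "(\<Sum>i\<in>latent_index J G. latent_coeff G testlet A j i * x i) \<le> std_threshold testlet A d j \<longleftrightarrow>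
    x (Suc G + j) \<le> d $ j + A $$ (j, 0) * x 0 + A $$ (j, testlet j) * x (testlet j)"
proof -
  have "x (Suc G + j) / item_sd testlet A j - std_main testlet A j * x 0 - std_testlet testlet A j * x (testlet j) =
      (x (Suc G + j) - A $$ (j, 0) * x 0 - A $$ (j, testlet j) * x (testlet j)) / item_sd testlet A j"
    by (simp add: std_main_def std_testlet_def diff_divide_distrib)
  then show ?thesis
    using item_sd_pos[of testlet A j]
    unfolding latent_form[OF assms] std_threshold_def by (auto simp: divide_le_cancel)
qed

lemma measurable_latent_form:
  "(\<lambda>x. \<Sum>i\<in>latent_index J G. c i * x i) \<in> borel_measurable (std_gauss (latent_index J G))"
  by (intro borel_measurable_sum borel_measurable_times borel_measurable_const measurable_std_gauss_component)

text \<open>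
The response pattern that the latent variables produce by thresholding.
\<close>

definition latent_pattern :: "nat \<Rightarrow> nat \<Rightarrow> (nat \<Rightarrow> nat) \<Rightarrow> real mat \<Rightarrow> real vec \<Rightarrow> (nat \<Rightarrow> real) \<Rightarrow> nat \<Rightarrow> bool" where
  "latent_pattern J G testlet A d x j \<longleftrightarrow>
     j < J \<and> (\<Sum>i\<in>latent_index J G. latent_coeff G testlet A j i * x i) \<le> std_threshold testlet A d j"

lemma integral_std_normal_indicator:
  "(\<integral>z. indicator {z. P \<longleftrightarrow> z \<le> m} z \<partial>std_normal_distribution) = (if P then Phi m else 1 - Phi m)"
proof -
  interpret N: prob_space std_normal_distribution by (rule prob_space_normal_density) simp
  have "measure std_normal_distribution (space std_normal_distribution - {..m}) = 1 - Phi m"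
    unfolding Phi_altdef by (rule N.prob_compl) simp
  moreover have "space std_normal_distribution - {..m} = {z. \<not> z \<le> m}" by auto
  moreover have "{..m} = {z. z \<le> m}" by auto
  ultimately show ?thesis by (cases P) (simp_all add: Phi_altdef)
qed

text \<open>
Integrating out the noise coordinates first, for fixed factors, turns every threshold event into its
conditional probability under the probit link.
\<close>

lemma measure_response_law_latent:
  assumes ta: "testlet_assignment J G testlet" and y: "\<And>j. j \<ge> J \<Longrightarrow> \<not> y j"
  shows "measure (response_law J G testlet A d) {y} =
    measure (std_gauss (latent_index J G)) {x \<in> space (std_gauss (latent_index J G)). latent_pattern J G testlet A d x = y}"
proof -
  interpret product_sigma_finite "\<lambda>_. std_normal_distribution" by (rule product_sigma_finite_std_normal)
  interpret N: prob_space std_normal_distribution by (rule prob_space_normal_density) simp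
  interpret L: prob_space "std_gauss (latent_index J G)" by (rule prob_space_std_gauss)
  define m where "m j \<eta> = d $ j + A $$ (j, 0) * \<eta> 0 + A $$ (j, testlet j) * \<eta> (testlet j)" for j and \<eta> :: "nat \<Rightarrow> real"
  define B where "B j \<eta> = {z. y j \<longleftrightarrow> z \<le> m j \<eta>}" for j and \<eta> :: "nat \<Rightarrow> real"
  define f :: "(nat \<Rightarrow> real) \<Rightarrow> real" where "f x = (\<Prod>j<J. indicator (B j x) (x (Suc G + j)))" for x
  let ?E = "{x \<in> space (std_gauss (latent_index J G)). latent_pattern J G testlet A d x = y}"
  have E: "?E = {x \<in> space (std_gauss (latent_index J G)). \<forall>j\<in>{..<J}.
      (\<Sum>i\<in>latent_index J G. latent_coeff G testlet A j i * x i) \<le> std_threshold testlet A d j \<longleftrightarrow> y j}"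
    using y by (auto simp: latent_pattern_def fun_eq_iff not_less[symmetric])
  have E_sets: "?E \<in> sets (std_gauss (latent_index J G))"
    unfolding E using measurable_latent_form[measurable] by measurable
  have f: "f x = indicator ?E x" if "x \<in> space (std_gauss (latent_index J G))" for x
  proof -
    have "f x = (if \<forall>j<J. x (Suc G + j) \<in> B j x then 1 else 0)"
      unfolding f_def indicator_def by (auto simp: prod_zero_iff)
    also have "\<dots> = indicator ?E x"
      unfolding E using that latent_le_threshold_iff[OF ta, of _ A x d] by (auto simp: indicator_def B_def m_def)
    finally show ?thesis .
  qed
  have int: "integrable (std_gauss (latent_index J G)) f"
  proof -
    have "integrable (std_gauss (latent_index J G)) (indicator ?E :: _ \<Rightarrow> real)"
      by (rule L.integrable_const_bound[where B = 1, OF AE_I2 borel_measurable_indicator[OF E_sets]])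
         (simp add: indicator_def)
    then show ?thesis using f by (subst Bochner_Integration.integrable_cong[OF refl, of _ f]) auto
  qed
  have "?E \<inter> space (std_gauss (latent_index J G)) = ?E"
    by auto
  then have "measure (std_gauss (latent_index J G)) ?E = (\<integral>x. indicator ?E x \<partial>std_gauss (latent_index J G))"
    by simp
  also have "\<dots> = (\<integral>x. f x \<partial>std_gauss (latent_index J G))"
    by (intro Bochner_Integration.integral_cong) (simp_all add: f)
  also have "\<dots> = (\<integral>\<eta>. (\<integral>\<epsilon>. f (merge {0..G} {Suc G..<Suc G + J} (\<eta>, \<epsilon>))
      \<partial>PiM {Suc G..<Suc G + J} (\<lambda>_. std_normal_distribution)) \<partial>PiM {0..G} (\<lambda>_. std_normal_distribution))"
    using int unfolding std_gauss_def latent_index_def by (intro product_integral_fold) auto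
  also have "\<dots> = (\<integral>\<eta>. (\<Prod>j<J. if y j then item_response_prob testlet A d \<eta> j else 1 - item_response_prob testlet A d \<eta> j)
      \<partial>factor_law G)"
    unfolding factor_law_def
  proof (intro Bochner_Integration.integral_cong refl)
    fix \<eta> :: "nat \<Rightarrow> real"
    have "m j (merge {0..G} {Suc G..<Suc G + J} (\<eta>, \<epsilon>)) = m j \<eta>" if "j < J" for j \<epsilon>
      using testlet_range[OF ta that] by (simp add: m_def merge_def)
    then have f_merge: "f (merge {0..G} {Suc G..<Suc G + J} (\<eta>, \<epsilon>)) = (\<Prod>j<J. indicator (B j \<eta>) (\<epsilon> (Suc G + j)))" for \<epsilon>
      unfolding f_def by (intro prod.cong) (auto simp: B_def merge_def)
    have reindex: "(\<Prod>j<J. indicator (B j \<eta>) (\<epsilon> (Suc G + j))) =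
        (\<Prod>i\<in>{Suc G..<Suc G + J}. indicator (B (i - Suc G) \<eta>) (\<epsilon> i) :: real)" for \<epsilon> :: "nat \<Rightarrow> real"
      by (rule prod.reindex_bij_witness[where i = "\<lambda>i. i - Suc G" and j = "\<lambda>j. Suc G + j"]) auto
    have "(\<integral>\<epsilon>. f (merge {0..G} {Suc G..<Suc G + J} (\<eta>, \<epsilon>)) \<partial>PiM {Suc G..<Suc G + J} (\<lambda>_. std_normal_distribution)) =
      (\<integral>\<epsilon>. (\<Prod>i\<in>{Suc G..<Suc G + J}. indicator (B (i - Suc G) \<eta>) (\<epsilon> i)) \<partial>PiM {Suc G..<Suc G + J} (\<lambda>_. std_normal_distribution))"
      by (simp only: f_merge reindex)
    also have "\<dots> = (\<Prod>i\<in>{Suc G..<Suc G + J}. \<integral>z. indicator (B (i - Suc G) \<eta>) z \<partial>std_normal_distribution)"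
      by (intro product_integral_prod N.integrable_const_bound[where B=1]) (auto simp: B_def)
    also have "\<dots> = (\<Prod>j<J. \<integral>z. indicator (B j \<eta>) z \<partial>std_normal_distribution)"
      by (rule prod.reindex_bij_witness[where j = "\<lambda>i. i - Suc G" and i = "\<lambda>j. Suc G + j"]) auto
    also have "\<dots> = (\<Prod>j<J. if y j then item_response_prob testlet A d \<eta> j else 1 - item_response_prob testlet A d \<eta> j)"
      unfolding B_def integral_std_normal_indicator item_response_prob_def m_def ..
    finally show "(\<integral>\<epsilon>. f (merge {0..G} {Suc G..<Suc G + J} (\<eta>, \<epsilon>)) \<partial>PiM {Suc G..<Suc G + J} (\<lambda>_. std_normal_distribution)) =
      (\<Prod>j<J. if y j then item_response_prob testlet A d \<eta> j else 1 - item_response_prob testlet A d \<eta> j)" .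
  qed
  also have "\<dots> = measure (response_law J G testlet A d) {y}"
    by (rule measure_response_law[OF assms, symmetric])
  finally show ?thesis by simp
qed

definition patterns :: "nat \<Rightarrow> (nat \<Rightarrow> bool) set" where
  "patterns J = {y. \<forall>j\<ge>J. \<not> y j}"

lemma finite_patterns: "finite (patterns J)"
proof -
  have "patterns J \<subseteq> (\<lambda>S j. j \<in> S) ` Pow {..<J}"
  proof
    fix y assume "y \<in> patterns J"
    then have "y = (\<lambda>j. j \<in> {j. y j})" "{j. y j} \<in> Pow {..<J}"
      by (auto simp: patterns_def not_less[symmetric])
    then show "y \<in> (\<lambda>S j. j \<in> S) ` Pow {..<J}" by blast
  qed
  then show ?thesis by (rule finite_subset) simp
qed

lemma AE_response_law_patterns:
  assumes "testlet_assignment J G testlet"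
  shows "AE y in response_law J G testlet A d. y \<in> patterns J"
proof -
  have "set_pmf (conditional_response_law J testlet A d \<eta>) \<subseteq> patterns J" for \<eta>
    unfolding conditional_response_law_def
    using set_Pi_pmf_subset'[of "{..<J}" False] by (force simp: PiE_dflt_def patterns_def)
  then show ?thesis
    unfolding response_law_def
    by (subst AE_bind[where B = "count_space UNIV"])
       (auto intro!: measurable_prob_algebraD measurable_conditional_response_law[OF assms] simp: AE_measure_pmf_iff)
qed

lemma measure_response_law_event:
  assumes ta: "testlet_assignment J G testlet"
  shows "measure (response_law J G testlet A d) {y \<in> patterns J. P y} =
    measure (std_gauss (latent_index J G)) {x \<in> space (std_gauss (latent_index J G)). P (latent_pattern J G testlet A d x)}"
proof -
  let ?Y = "{y \<in> patterns J. P y}" and ?L = "std_gauss (latent_index J G)"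
  let ?E = "\<lambda>y. {x \<in> space ?L. latent_pattern J G testlet A d x = y}"
  interpret R: prob_space "response_law J G testlet A d" by (rule prob_space_response_law[OF ta])
  interpret L: prob_space ?L by (rule prob_space_std_gauss)
  have fin: "finite ?Y" using finite_patterns by simp
  have pat: "latent_pattern J G testlet A d x \<in> patterns J" for x
    by (simp add: patterns_def latent_pattern_def)
  have E_sets: "?E y \<in> sets ?L" if "y \<in> patterns J" for y
  proof -
    have "?E y = {x \<in> space ?L. \<forall>j\<in>{..<J}.
      (\<Sum>i\<in>latent_index J G. latent_coeff G testlet A j i * x i) \<le> std_threshold testlet A d j \<longleftrightarrow> y j}"
      using that by (auto simp: latent_pattern_def patterns_def fun_eq_iff not_less[symmetric])
    also have "\<dots> \<in> sets ?L"
      using measurable_latent_form[measurable] by measurable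
    finally show ?thesis .
  qed
  have "measure (response_law J G testlet A d) ?Y = (\<Sum>y\<in>?Y. measure (response_law J G testlet A d) {y})"
    using fin sets_response_law[OF ta] by (intro R.finite_measure_eq_sum_singleton) auto
  also have "\<dots> = (\<Sum>y\<in>?Y. measure ?L (?E y))"
    by (intro sum.cong refl measure_response_law_latent[OF ta]) (auto simp: patterns_def)
  also have "\<dots> = measure ?L (\<Union>y\<in>?Y. ?E y)"
    using fin E_sets by (intro L.finite_measure_finite_Union[symmetric]) (auto simp: disjoint_family_on_def)
  also have "(\<Union>y\<in>?Y. ?E y) = {x \<in> space ?L. P (latent_pattern J G testlet A d x)}"
    using pat by auto
  finally show ?thesis .
qed

text \<open>
From left to right, the events that one item or two items are answered \<open>True\<close> have probabilities
\<open>Phi t\<^sub>j\<close> and \<open>bivariate_cdf r\<^sub>i\<^sub>j t\<^sub>i t\<^sub>j\<close>, from which first the thresholds and then the correlations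
can be read off. From right to left, every response pattern is an event that restricts each latent
variable separately, so its probability is a function of thresholds and covariances.
\<close>

lemma response_law_eq_iff:
  assumes ta: "testlet_assignment J G testlet"
  shows "response_law J G testlet A' d' = response_law J G testlet A d \<longleftrightarrow>
    (\<forall>j<J. std_threshold testlet A' d' j = std_threshold testlet A d j) \<and>
    (\<forall>i<J. \<forall>j<J. i \<noteq> j \<longrightarrow> item_corr testlet (std_main testlet A') (std_testlet testlet A') i j =
       item_corr testlet (std_main testlet A) (std_testlet testlet A) i j)"
    (is "?R A' d' = ?R A d \<longleftrightarrow> ?T \<and> ?C")
proof
  let ?L = "std_gauss (latent_index J G)"
  have fin: "finite (latent_index J G)" by (simp add: latent_index_def)
  assume eq: "?R A' d' = ?R A d"
  have marg: "measure (?R A d) {y \<in> patterns J. y j} = Phi (std_threshold testlet A d j)" if j: "j < J" for A d j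
  proof -
    have "measure (?R A d) {y \<in> patterns J. y j} = measure ?L {x \<in> space ?L.
        (\<Sum>i\<in>latent_index J G. latent_coeff G testlet A j i * x i) \<le> std_threshold testlet A d j}"
      using j by (simp add: measure_response_law_event[OF ta] latent_pattern_def)
    also have "\<dots> = Phi (std_threshold testlet A d j)"
      by (rule gaussian_marginal[OF fin]) (simp add: latent_cov[OF ta j j] power2_eq_square)
    finally show ?thesis .
  qed
  have T: "std_threshold testlet A' d' j = std_threshold testlet A d j" if "j < J" for j
    using marg[OF that, of A d] marg[OF that, of A' d'] eq by (simp add: inj_Phi)
  have joint: "measure (?R A d) {y \<in> patterns J. y i \<and> y j} =
      bivariate_cdf (item_corr testlet (std_main testlet A) (std_testlet testlet A) i j)
        (std_threshold testlet A d i) (std_threshold testlet A d j)"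
    if ij: "i < J" "j < J" "i \<noteq> j" for A d i j
  proof -
    have "measure (?R A d) {y \<in> patterns J. y i \<and> y j} = measure ?L {x \<in> space ?L.
        (\<Sum>k\<in>latent_index J G. latent_coeff G testlet A i k * x k) \<le> std_threshold testlet A d i \<and>
        (\<Sum>k\<in>latent_index J G. latent_coeff G testlet A j k * x k) \<le> std_threshold testlet A d j}"
      using ij by (simp add: measure_response_law_event[OF ta] latent_pattern_def)
    also have "\<dots> = bivariate_cdf (item_corr testlet (std_main testlet A) (std_testlet testlet A) i j)
        (std_threshold testlet A d i) (std_threshold testlet A d j)"
    proof (rule gaussian_bivariate[OF fin])
      show "\<bar>item_corr testlet (std_main testlet A) (std_testlet testlet A) i j\<bar> < 1"
        by (intro abs_item_corr_less_1 std_norm_less_1)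
    qed (use ij in \<open>simp_all add: latent_cov[OF ta] power2_eq_square\<close>)
    finally show ?thesis .
  qed
  have "item_corr testlet (std_main testlet A') (std_testlet testlet A') i j =
      item_corr testlet (std_main testlet A) (std_testlet testlet A) i j" if ij: "i < J" "j < J" "i \<noteq> j" for i j
  proof (rule bivariate_cdf_inj)
    show "bivariate_cdf (item_corr testlet (std_main testlet A') (std_testlet testlet A') i j)
        (std_threshold testlet A d i) (std_threshold testlet A d j) =
      bivariate_cdf (item_corr testlet (std_main testlet A) (std_testlet testlet A) i j)
        (std_threshold testlet A d i) (std_threshold testlet A d j)"
      using joint[OF ij, of A d] joint[OF ij, of A' d'] eq T[OF ij(1)] T[OF ij(2)] by simp
  qed (intro abs_item_corr_less_1 std_norm_less_1)+
  then show "?T \<and> ?C" using T by blast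
next
  let ?L = "std_gauss (latent_index J G)"
  assume TC: "?T \<and> ?C"
  show "?R A' d' = ?R A d"
  proof (rule measure_eqI_countable_AE[OF sets_response_law[OF ta] sets_response_law[OF ta]
        AE_response_law_patterns[OF ta] AE_response_law_patterns[OF ta]])
    show "countable (patterns J)" using finite_patterns by (rule countable_finite)
    fix y assume y: "y \<in> patterns J"
    interpret R: prob_space "?R A d" by (rule prob_space_response_law[OF ta])
    interpret R': prob_space "?R A' d'" by (rule prob_space_response_law[OF ta])
    define B where "B j = {z. y j \<longleftrightarrow> z \<le> std_threshold testlet A d j}" for j
    have box: "measure (?R A d') {y} = measure ?L {x \<in> space ?L. \<forall>j\<in>{..<J}.
        (\<Sum>i\<in>latent_index J G. latent_coeff G testlet A j i * x i) \<in> B j}"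
      if "\<forall>j<J. std_threshold testlet A d' j = std_threshold testlet A0 d0 j"
         "B = (\<lambda>j. {z. y j \<longleftrightarrow> z \<le> std_threshold testlet A0 d0 j})" for A d' A0 d0 B
    proof -
      have "measure (?R A d') {y} = measure ?L {x \<in> space ?L. latent_pattern J G testlet A d' x = y}"
        using y by (intro measure_response_law_latent[OF ta]) (auto simp: patterns_def)
      also have "{x \<in> space ?L. latent_pattern J G testlet A d' x = y} = {x \<in> space ?L. \<forall>j\<in>{..<J}.
          (\<Sum>i\<in>latent_index J G. latent_coeff G testlet A j i * x i) \<in> B j}"
      proof -
        have yJ: "j < J" if "y j" for j using y that by (auto simp: patterns_def not_less[symmetric])
        have "(\<forall>j. (j < J \<and> z j \<le> std_threshold testlet A d' j) = y j) \<longleftrightarrow> (\<forall>j\<in>{..<J}. z j \<in> B j)" for z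
          unfolding that(2)
        proof (rule iffI; (rule ballI | rule allI))
          fix j assume *: "\<forall>j. (j < J \<and> z j \<le> std_threshold testlet A d' j) = y j" and "j \<in> {..<J}"
          then have j: "j < J" by simp
          have "y j = (z j \<le> std_threshold testlet A0 d0 j)"
            unfolding *[rule_format, of j, symmetric] that(1)[rule_format, OF j] by (simp only: j simp_thms)
          then show "z j \<in> {z. y j = (z \<le> std_threshold testlet A0 d0 j)}"
            by (rule CollectI)
        next
          fix j assume *: "\<forall>j\<in>{..<J}. z j \<in> {z. y j = (z \<le> std_threshold testlet A0 d0 j)}"
          show "(j < J \<and> z j \<le> std_threshold testlet A d' j) = y j"
          proof (cases "j < J")
            case True
            then have "y j = (z j \<le> std_threshold testlet A0 d0 j)"
              using bspec[OF *, of j] by blast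
            then show ?thesis
              unfolding that(1)[rule_format, OF True] by (simp only: True simp_thms)
          next
            case False
            then show ?thesis using yJ[of j] by blast
          qed
        qed
        then show ?thesis unfolding latent_pattern_def fun_eq_iff by (simp only:)
      qed
      finally show ?thesis .
    qed
    have "measure ?L {x \<in> space ?L. \<forall>j\<in>{..<J}. (\<Sum>i\<in>latent_index J G. latent_coeff G testlet A' j i * x i) \<in> B j} =
      measure ?L {x \<in> space ?L. \<forall>j\<in>{..<J}. (\<Sum>i\<in>latent_index J G. latent_coeff G testlet A j i * x i) \<in> B j}"
    proof (rule gaussian_joint_law_determined_by_covariance)
      show "finite (latent_index J G)" by (simp add: latent_index_def)
      then show "finite (latent_index J G)" .
      show "B j \<in> sets borel" for j by (cases "y j") (simp_all add: B_def)
      fix i j assume "i \<in> {..<J}" "j \<in> {..<J}"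
      then show "(\<Sum>k\<in>latent_index J G. latent_coeff G testlet A' i k * latent_coeff G testlet A' j k) =
          (\<Sum>k\<in>latent_index J G. latent_coeff G testlet A i k * latent_coeff G testlet A j k)"
        using TC by (simp add: latent_cov[OF ta])
    qed simp
    moreover have B: "B = (\<lambda>j. {z. y j \<longleftrightarrow> z \<le> std_threshold testlet A d j})"
      by (simp add: B_def fun_eq_iff)
    ultimately have "measure (?R A' d') {y} = measure (?R A d) {y}"
      using box[OF conjunct1[OF TC] B] box[OF _ B, of A d] by simp
    then show "emeasure (?R A' d') {y} = emeasure (?R A d) {y}"
      by (simp add: R.emeasure_eq_measure R'.emeasure_eq_measure)
  qed
qed

section \<open>Column signs and products of loadings\<close>

text \<open>
On the three distinguished indices the ratios \<open>y / x\<close> have pairwise products 1, so they are equal and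
square to 1. Any other index differs in label from one of the three and inherits the ratio. The labels
will be the testlets, for main loadings, or the items themselves, for testlet loadings.
\<close>

lemma rank_one_products_determine_up_to_sign:
  fixes x y :: "'a \<Rightarrow> real" and lab :: "'a \<Rightarrow> 'b"
  assumes eq: "\<And>i j. i \<in> S \<Longrightarrow> j \<in> S \<Longrightarrow> lab i \<noteq> lab j \<Longrightarrow> y i * y j = x i * x j"
    and S: "i \<in> S" "j \<in> S" "k \<in> S" and nz: "x i \<noteq> 0" "x j \<noteq> 0" "x k \<noteq> 0"
    and lab: "lab i \<noteq> lab j" "lab i \<noteq> lab k" "lab j \<noteq> lab k"
  shows "\<exists>\<epsilon>\<in>{1, -1}. \<forall>l\<in>S. y l = \<epsilon> * x l"
proof -
  define \<rho> where "\<rho> m = y m / x m" for m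
  have y: "y m = \<rho> m * x m" if "x m \<noteq> 0" for m using that by (simp add: \<rho>_def)
  have prods: "\<rho> i * \<rho> j = 1" "\<rho> i * \<rho> k = 1" "\<rho> j * \<rho> k = 1"
    using eq[OF S(1,2) lab(1)] eq[OF S(1,3) lab(2)] eq[OF S(2,3) lab(3)] nz
    by (simp_all add: \<rho>_def)
  then have "\<rho> j \<noteq> 0" "\<rho> k \<noteq> 0" by auto
  then have "\<rho> j = \<rho> i" "\<rho> k = \<rho> i"
    using prods by (metis mult_right_cancel, metis mult_right_cancel mult.commute)
  then have "\<rho> j = \<rho> i" "\<rho> k = \<rho> i" "\<rho> i * \<rho> i = 1"
    using prods(1) by simp_all
  then have \<rho>: "\<rho> i \<in> {1, -1}" "y i = \<rho> i * x i" "y j = \<rho> i * x j" "y k = \<rho> i * x k" "\<rho> i * \<rho> i = 1"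
    using y[of i] y[of j] y[of k] nz by (auto simp: square_eq_1_iff)
  have "y l = \<rho> i * x l" if "l \<in> S" for l
  proof -
    have "y l = \<rho> i * x l" if "m \<in> S" "lab l \<noteq> lab m" "y m = \<rho> i * x m" "x m \<noteq> 0" for m
    proof -
      have "y l * \<rho> i * x m = x l * x m" using eq[OF \<open>l \<in> S\<close> that(1,2)] that(3) by (simp add: mult.assoc)
      then have "y l * \<rho> i = x l" using that(4) by simp
      then have "y l * (\<rho> i * \<rho> i) = \<rho> i * x l" by (simp add: algebra_simps)
      then show ?thesis using \<rho>(5) by simp
    qed
    then show ?thesis using S \<rho> nz lab by metis
  qed
  then show ?thesis using \<rho>(1) by blast
qed

text \<open>
The sign convention of the parameter space for a single column.
\<close>

definition sign_normalised :: "nat \<Rightarrow> (nat \<Rightarrow> real) \<Rightarrow> bool" where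
  "sign_normalised J x \<longleftrightarrow> (\<forall>j<J. x j \<noteq> 0 \<and> (\<forall>i<j. x i = 0) \<longrightarrow> x j > 0)"

lemma sign_normalised_unique:
  assumes "sign_normalised J x" "sign_normalised J y" and \<epsilon>: "\<epsilon> \<in> {1, -1}" "\<And>j. j < J \<Longrightarrow> y j = \<epsilon> * x j"
    and j: "j < J"
  shows "y j = x j"
proof (cases "\<exists>i<J. x i \<noteq> 0")
  case True
  define m where "m = (LEAST i. i < J \<and> x i \<noteq> 0)"
  have m: "m < J" "x m \<noteq> 0" using LeastI_ex[OF True] by (simp_all add: m_def)
  have "x i = 0" if "i < m" for i
    using not_less_Least[of i "\<lambda>i. i < J \<and> x i \<noteq> 0"] that m(1) by (simp add: m_def)
  moreover from this have "y i = 0" if "i < m" for i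
    using \<epsilon>(2)[of i] that m(1) by simp
  moreover have "y m \<noteq> 0" using \<epsilon>(1) \<epsilon>(2)[OF m(1)] m(2) by auto
  ultimately have "x m > 0" "y m > 0"
    using assms(1,2) m unfolding sign_normalised_def by blast+
  then have "\<epsilon> = 1" using \<epsilon>(1) \<epsilon>(2)[OF m(1)] by auto
  then show ?thesis using \<epsilon>(2)[OF j] by simp
next
  case False
  then show ?thesis using \<epsilon>(2)[OF j] j by simp
qed

lemma sign_normalised_divide:
  assumes "sign_normalised J x" "\<And>j. s j > 0"
  shows "sign_normalised J (\<lambda>j. x j / s j)"
  unfolding sign_normalised_def
proof (intro allI impI)
  fix j assume j: "j < J" and first: "x j / s j \<noteq> 0 \<and> (\<forall>i<j. x i / s i = 0)"
  have "s i \<noteq> 0" for i using assms(2)[of i] by simp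
  then have "x j \<noteq> 0 \<and> (\<forall>i<j. x i = 0)" using first by simp
  then have "x j > 0" using assms(1) j unfolding sign_normalised_def by blast
  then show "x j / s j > 0" using assms(2) by simp
qed

definition column_sign :: "nat \<Rightarrow> (nat \<Rightarrow> real) \<Rightarrow> real" where
  "column_sign J x = (if \<exists>j<J. x j < 0 \<and> (\<forall>i<j. x i = 0) then -1 else 1)"

lemma column_sign_cases: "column_sign J x = 1 \<or> column_sign J x = -1"
  by (simp add: column_sign_def)

lemma sign_normalised_column_sign: "sign_normalised J (\<lambda>j. column_sign J x * x j)"
  unfolding sign_normalised_def
proof (intro allI impI)
  fix j assume j: "j < J" and first: "column_sign J x * x j \<noteq> 0 \<and> (\<forall>i<j. column_sign J x * x i = 0)"
  then have xj: "x j \<noteq> 0" "\<forall>i<j. x i = 0"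
    using column_sign_cases[of J x] by auto
  show "column_sign J x * x j > 0"
  proof (cases "x j < 0")
    case True
    then have "column_sign J x = -1" using j xj by (auto simp: column_sign_def)
    then show ?thesis using True by simp
  next
    case False
    have "\<not> (x k < 0 \<and> (\<forall>i<k. x i = 0))" for k
      using False xj by (metis less_irrefl linorder_neqE_nat)
    then have "column_sign J x = 1" by (simp add: column_sign_def)
    then show ?thesis using False xj by simp
  qed
qed

lemma card_ge_3_avoid:
  assumes "card Q \<ge> 3"
  obtains q where "q \<in> Q" "q \<noteq> a" "q \<noteq> b"
proof -
  have "\<not> Q \<subseteq> {a, b}"
    using assms card_mono[of "{a, b}" Q] card_insert_le_m1[of 2 "{b}" a] by fastforce
  then show ?thesis using that by blast
qed

lemma card_ge_4_avoid:
  assumes "card Q \<ge> 4"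
  obtains q where "q \<in> Q" "q \<noteq> a" "q \<noteq> b" "q \<noteq> c"
proof -
  have "card (Q - {c}) \<ge> 3" using assms by (cases "c \<in> Q") (simp_all add: card_Diff_singleton)
  from card_ge_3_avoid[OF this, of a b] show ?thesis using that by blast
qed

section \<open>Identifiability in terms of standardised loadings\<close>

lemma parameter_space_iff:
  "(A, d) \<in> parameter_space J G testlet \<longleftrightarrow> A \<in> carrier_mat J (1 + G) \<and> d \<in> carrier_vec J \<and>
     (\<forall>j<J. \<forall>g\<in>{1..G}. g \<noteq> testlet j \<longrightarrow> A $$ (j, g) = 0) \<and>
     (\<forall>g\<le>G. sign_normalised J (\<lambda>j. A $$ (j, g)))"
  unfolding parameter_space_def sign_normalised_def by simp

text \<open>
The standard deviation can be recovered from the standardised loadings: \<open>1 / s\<^sup>2 = 1 - b\<^sup>2 - w\<^sup>2\<close>.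
\<close>

lemma parameters_determined_by_standardisation:
  assumes ps: "(A, d) \<in> parameter_space J G testlet" "(A', d') \<in> parameter_space J G testlet"
    and main: "\<And>j. j < J \<Longrightarrow> std_main testlet A' j = std_main testlet A j"
    and test: "\<And>j. j < J \<Longrightarrow> std_testlet testlet A' j = std_testlet testlet A j"
    and thr: "\<And>j. j < J \<Longrightarrow> std_threshold testlet A' d' j = std_threshold testlet A d j"
  shows "(A', d') = (A, d)"
proof -
  have sd: "item_sd testlet A' j = item_sd testlet A j" if "j < J" for j
  proof -
    have "1 / (item_sd testlet A' j)\<^sup>2 = 1 / (item_sd testlet A j)\<^sup>2"
      using std_norm[of testlet A j] std_norm[of testlet A' j] unfolding main[OF that] test[OF that] by linarith
    then have "(item_sd testlet A' j)\<^sup>2 = (item_sd testlet A j)\<^sup>2" by simp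
    then show ?thesis using item_sd_pos by (simp add: power2_eq_iff_nonneg less_imp_le)
  qed
  have eq: "A' $$ (j, 0) = A $$ (j, 0)" "A' $$ (j, testlet j) = A $$ (j, testlet j)" "d' $ j = d $ j" if "j < J" for j
    using main[OF that] test[OF that] thr[OF that] sd[OF that] item_sd_pos[of testlet A j]
    by (simp_all add: std_main_def std_testlet_def std_threshold_def)
  note * = ps[unfolded parameter_space_iff]
  have "A' = A"
  proof (rule eq_matI)
    fix j g assume "j < dim_row A" "g < dim_col A"
    then have "j < J" "g \<le> G" using * by auto
    then show "A' $$ (j, g) = A $$ (j, g)"
      using eq[of j] * by (cases "g = 0"; cases "g = testlet j") auto
  qed (use * in auto)
  moreover have "d' = d" using * eq(3) by (intro eq_vecI) auto
  ultimately show ?thesis by simp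
qed

text \<open>
Sufficient criterion in terms of products alone: the sign convention removes the remaining freedom of
one sign per column.
\<close>

lemma identifiableI:
  assumes ta: "testlet_assignment J G testlet" and ps: "(A, d) \<in> parameter_space J G testlet"
    and up_to_sign: "\<And>b w. (\<And>i j. i < J \<Longrightarrow> j < J \<Longrightarrow> i \<noteq> j \<Longrightarrow> item_corr testlet b w i j =
          item_corr testlet (std_main testlet A) (std_testlet testlet A) i j) \<Longrightarrow>
        (\<exists>\<epsilon>\<in>{1, -1}. \<forall>j\<in>{..<J}. b j = \<epsilon> * std_main testlet A j) \<and>
        (\<forall>g\<in>{1..G}. \<exists>\<epsilon>\<in>{1, -1}. \<forall>j\<in>testlet_items J testlet g. w j = \<epsilon> * std_testlet testlet A j)"
  shows "identifiable_at J G testlet A d"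
  unfolding identifiable_at_def
proof (clarify)
  fix A' d' assume ps': "(A', d') \<in> parameter_space J G testlet"
    and law: "response_law J G testlet A' d' = response_law J G testlet A d"
  note thr_corr = law[unfolded response_law_eq_iff[OF ta]]
  have sgn: "(\<exists>\<epsilon>\<in>{1, -1}. \<forall>j\<in>{..<J}. std_main testlet A' j = \<epsilon> * std_main testlet A j) \<and>
        (\<forall>g\<in>{1..G}. \<exists>\<epsilon>\<in>{1, -1}. \<forall>j\<in>testlet_items J testlet g. std_testlet testlet A' j = \<epsilon> * std_testlet testlet A j)"
    by (rule up_to_sign) (use thr_corr in blast)
  have norm: "sign_normalised J (\<lambda>j. C $$ (j, g) / item_sd testlet C j)"
    if "(C, e) \<in> parameter_space J G testlet" "g \<le> G" for C e g
    using that by (intro sign_normalised_divide item_sd_pos) (simp add: parameter_space_iff)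
  have main: "std_main testlet A' j = std_main testlet A j" if "j < J" for j
  proof -
    obtain \<epsilon> where \<epsilon>: "\<epsilon> \<in> {1, -1}" "\<forall>j\<in>{..<J}. std_main testlet A' j = \<epsilon> * std_main testlet A j"
      using sgn by blast
    show ?thesis
      by (rule sign_normalised_unique[OF _ _ \<epsilon>(1) _ that])
         (use norm[OF ps, of 0] norm[OF ps', of 0] \<epsilon>(2) in \<open>auto simp: std_main_def[abs_def]\<close>)
  qed
  have test: "std_testlet testlet A' j = std_testlet testlet A j" if j: "j < J" for j
  proof -
    define g where "g = testlet j"
    have g: "1 \<le> g" "g \<le> G" using testlet_range[OF ta j] by (simp_all add: g_def)
    then obtain \<epsilon> where \<epsilon>: "\<epsilon> \<in> {1, -1}"
      "\<forall>j\<in>testlet_items J testlet g. std_testlet testlet A' j = \<epsilon> * std_testlet testlet A j"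
      using sgn by (meson atLeastAtMost_iff)
    have col: "C $$ (i, g) / item_sd testlet C i = (if testlet i = g then std_testlet testlet C i else 0)"
      if "(C, e) \<in> parameter_space J G testlet" "i < J" for C e i
      using that g by (auto simp: parameter_space_iff std_testlet_def)
    have "A' $$ (j, g) / item_sd testlet A' j = A $$ (j, g) / item_sd testlet A j"
    proof (rule sign_normalised_unique[OF norm[OF ps g(2)] norm[OF ps' g(2)] \<epsilon>(1) _ j])
      fix i assume i: "i < J"
      show "A' $$ (i, g) / item_sd testlet A' i = \<epsilon> * (A $$ (i, g) / item_sd testlet A i)"
        unfolding col[OF ps i] col[OF ps' i] using \<epsilon>(2) i by (auto simp: testlet_items_def)
    qed
    then show ?thesis by (simp add: std_testlet_def g_def)
  qed
  show "A' = A \<and> d' = d"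
    using parameters_determined_by_standardisation[OF ps ps' main test] thr_corr by blast
qed

text \<open>
Dividing a point \<open>(b, w)\<close> of the open unit disc by \<open>sqrt (1 - b\<^sup>2 - w\<^sup>2)\<close> inverts the standardisation.
Enforcing the sign convention then multiplies whole columns by signs, which leaves all correlations
unchanged.
\<close>

lemma parameters_realising_standardisation:
  fixes b w t :: "nat \<Rightarrow> real"
  assumes ta: "testlet_assignment J G testlet" and less_1: "\<And>j. j < J \<Longrightarrow> (b j)\<^sup>2 + (w j)\<^sup>2 < 1"
  obtains A d where "(A, d) \<in> parameter_space J G testlet"
    and "\<And>i j. i < J \<Longrightarrow> j < J \<Longrightarrow>
      item_corr testlet (std_main testlet A) (std_testlet testlet A) i j = item_corr testlet b w i j"
    and "\<And>j. j < J \<Longrightarrow> std_threshold testlet A d j = t j"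
    and "\<And>j. j < J \<Longrightarrow> \<bar>std_main testlet A j\<bar> = \<bar>b j\<bar> \<and> \<bar>std_testlet testlet A j\<bar> = \<bar>w j\<bar>"
proof -
  \<comment> \<open>The standard deviation of the item to be constructed.\<close>
  define s where "s j = 1 / sqrt (1 - (b j)\<^sup>2 - (w j)\<^sup>2)" for j
  have s: "s j > 0" "1 + (b j * s j)\<^sup>2 + (w j * s j)\<^sup>2 = (s j)\<^sup>2" if "j < J" for j
  proof -
    define q where "q = 1 - (b j)\<^sup>2 - (w j)\<^sup>2"
    have q: "q > 0" "(b j)\<^sup>2 + (w j)\<^sup>2 = 1 - q" using less_1[OF that] by (simp_all add: q_def)
    have s2: "(s j)\<^sup>2 = 1 / q" using q(1) by (simp add: s_def q_def[symmetric] power_divide)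
    show "s j > 0" using q(1) by (simp add: s_def q_def[symmetric])
    have "1 + (b j * s j)\<^sup>2 + (w j * s j)\<^sup>2 = 1 + ((b j)\<^sup>2 + (w j)\<^sup>2) * (s j)\<^sup>2"
      by (simp add: power_mult_distrib algebra_simps)
    also have "\<dots> = (s j)\<^sup>2" unfolding q(2) s2 using q(1) by (simp add: field_simps)
    finally show "1 + (b j * s j)\<^sup>2 + (w j * s j)\<^sup>2 = (s j)\<^sup>2" .
  qed
  define col where "col g j = (if g = 0 then b j * s j else if testlet j = g then w j * s j else 0)" for g j
  define \<sigma> where "\<sigma> g = column_sign J (col g)" for g
  have \<sigma>: "\<sigma> g = 1 \<or> \<sigma> g = -1" for g unfolding \<sigma>_def by (rule column_sign_cases)
  define A where "A = mat J (1 + G) (\<lambda>(j, g). \<sigma> g * col g j)"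
  define d where "d = vec J (\<lambda>j. t j * s j)"
  have A: "A $$ (j, g) = \<sigma> g * col g j" if "j < J" "g \<le> G" for j g
    using that by (simp add: A_def)
  have t1: "1 \<le> testlet j" "testlet j \<le> G" "testlet j \<noteq> 0" if "j < J" for j
    using testlet_range[OF ta that] by auto
  have A0: "A $$ (j, 0) = \<sigma> 0 * (b j * s j)" "A $$ (j, testlet j) = \<sigma> (testlet j) * (w j * s j)" if "j < J" for j
    using that t1[OF that] by (simp_all add: A col_def)
  have sd: "item_sd testlet A j = s j" if "j < J" for j
  proof -
    have "(\<sigma> g * x)\<^sup>2 = x\<^sup>2" for g x using \<sigma>[of g] by auto
    then show ?thesis
      using s[OF that] unfolding item_sd_def A0[OF that] by (simp only:) simp
  qed
  have main: "std_main testlet A j = \<sigma> 0 * b j" "std_testlet testlet A j = \<sigma> (testlet j) * w j"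
    "std_threshold testlet A d j = t j" if "j < J" for j
    using s(1)[OF that] that by (simp_all add: std_main_def std_testlet_def std_threshold_def sd A0 d_def)
  show ?thesis
  proof (rule that[of A d])
    show "(A, d) \<in> parameter_space J G testlet"
      unfolding parameter_space_iff
    proof (intro conjI allI ballI impI)
      show "A $$ (j, g) = 0" if "j < J" "g \<in> {1..G}" "g \<noteq> testlet j" for j g
        using that by (simp add: A col_def)
      fix g assume g: "g \<le> G"
      have "sign_normalised J (\<lambda>j. \<sigma> g * col g j)"
        unfolding \<sigma>_def by (rule sign_normalised_column_sign)
      then show "sign_normalised J (\<lambda>j. A $$ (j, g))"
        using g by (simp add: sign_normalised_def A)
    qed (simp_all add: A_def d_def)
    fix i j assume ij: "i < J" "j < J"
    have "(\<sigma> g * x) * (\<sigma> g * y) = x * y" for g x y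
      using \<sigma>[of g] by auto
    note cancel = this[of 0 "b i" "b j"] this[of "testlet j" "w i" "w j"]
    show "item_corr testlet (std_main testlet A) (std_testlet testlet A) i j = item_corr testlet b w i j"
      unfolding item_corr_def main(1,2)[OF ij(1)] main(1,2)[OF ij(2)]
      by (cases "testlet i = testlet j") (simp_all only: cancel if_True if_False)
  next
    show "\<bar>std_main testlet A j\<bar> = \<bar>b j\<bar> \<and> \<bar>std_testlet testlet A j\<bar> = \<bar>w j\<bar>" if "j < J" for j
      using \<sigma>[of 0] \<sigma>[of "testlet j"] by (auto simp: main[OF that])
  qed (rule main(3))
qed

text \<open>
Alternative standardised loadings with the same correlations refute identifiability. They are compared in
absolute value because their columns may still have to change sign to meet the sign convention.
\<close>

lemma not_identifiableI:
  assumes ta: "testlet_assignment J G testlet" and ps: "(A, d) \<in> parameter_space J G testlet"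
    and less_1: "\<And>j. j < J \<Longrightarrow> (b j)\<^sup>2 + (w j)\<^sup>2 < 1"
    and corr: "\<And>i j. i < J \<Longrightarrow> j < J \<Longrightarrow> i \<noteq> j \<Longrightarrow> item_corr testlet b w i j =
          item_corr testlet (std_main testlet A) (std_testlet testlet A) i j"
    and p: "p < J" "\<bar>b p\<bar> \<noteq> \<bar>std_main testlet A p\<bar> \<or> \<bar>w p\<bar> \<noteq> \<bar>std_testlet testlet A p\<bar>"
  shows "\<not> identifiable_at J G testlet A d"
proof
  assume ident: "identifiable_at J G testlet A d"
  obtain A' d' where ps': "(A', d') \<in> parameter_space J G testlet"
    and c: "\<And>i j. i < J \<Longrightarrow> j < J \<Longrightarrow>
      item_corr testlet (std_main testlet A') (std_testlet testlet A') i j = item_corr testlet b w i j"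
    and t: "\<And>j. j < J \<Longrightarrow> std_threshold testlet A' d' j = std_threshold testlet A d j"
    and a: "\<And>j. j < J \<Longrightarrow> \<bar>std_main testlet A' j\<bar> = \<bar>b j\<bar> \<and> \<bar>std_testlet testlet A' j\<bar> = \<bar>w j\<bar>"
    using parameters_realising_standardisation[where b = b and w = w and t = "std_threshold testlet A d", OF ta less_1] by blast
  have "response_law J G testlet A' d' = response_law J G testlet A d"
    unfolding response_law_eq_iff[OF ta] using c t corr by simp
  then have "A' = A" using ident ps' unfolding identifiable_at_def by auto
  then show False using a[OF p(1)] p(2) by simp
qed

section \<open>Disjoint independent pairs of rows\<close>

text \<open>
Among the rows \<open>(u i, w i)\<close> with \<open>i \<in> B\<close> there are two disjoint pairs of linearly independent ones. For
the rows of a testlet this is membership in \<open>H2_set\<close>, and it is invariant under rescaling of rows.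
\<close>

definition has_disjoint_bases :: "'a set \<Rightarrow> ('a \<Rightarrow> real) \<Rightarrow> ('a \<Rightarrow> real) \<Rightarrow> bool" where
  "has_disjoint_bases B u w \<longleftrightarrow> (\<exists>i\<in>B. \<exists>j\<in>B. \<exists>k\<in>B. \<exists>l\<in>B. {i, j} \<inter> {k, l} = {} \<and>
     u i * w j \<noteq> u j * w i \<and> u k * w l \<noteq> u l * w k)"

lemma has_disjoint_basesI:
  assumes "i \<in> B" "j \<in> B" "k \<in> B" "l \<in> B" "{i, j} \<inter> {k, l} = {}"
    and "u i * w j \<noteq> u j * w i" "u k * w l \<noteq> u l * w k"
  shows "has_disjoint_bases B u w"
  unfolding has_disjoint_bases_def
  by (rule bexI[OF _ assms(1)], rule bexI[OF _ assms(2)], rule bexI[OF _ assms(3)], rule bexI[OF _ assms(4)])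
     (intro conjI assms)

lemma not_has_disjoint_basesD:
  assumes "\<not> has_disjoint_bases B u w" "u i * w j \<noteq> u j * w i"
    and "i \<in> B" "j \<in> B" "k \<in> B" "l \<in> B" "k \<noteq> i" "k \<noteq> j" "l \<noteq> i" "l \<noteq> j"
  shows "u k * w l = u l * w k"
  using assms unfolding has_disjoint_bases_def by blast

text \<open>
Group the nonzero rows \<open>(u i, w i)\<close> into classes of parallel rows. Two disjoint pairs of non-parallel rows exist
as soon as there are at least four nonzero rows and at least two of them lie outside the largest class.
So without such pairs, either all rows except one are multiples of a common \<open>(r, 1)\<close>, or there are just three
nonzero rows; the lower bound on the number of nonzero \<open>w i\<close> excludes that the common direction is
\<open>(1, 0)\<close>.
\<close>

lemma no_disjoint_bases_structure:
  assumes ns: "\<not> has_disjoint_bases B u w" and card: "card {i \<in> B. w i \<noteq> 0} \<ge> 3"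
  shows "(\<exists>p\<in>B. \<exists>r. \<forall>i\<in>B - {p}. u i = r * w i) \<or>
    (\<exists>i j k. i \<noteq> j \<and> i \<noteq> k \<and> j \<noteq> k \<and> {i \<in> B. w i \<noteq> 0} = {i, j, k} \<and> (\<forall>l\<in>B. w l = 0 \<longrightarrow> u l = 0))"
proof -
  let ?Q = "{i \<in> B. w i \<noteq> 0}"
  \<comment> \<open>On \<open>?Q\<close>, parallel rows are those with equal ratio.\<close>
  define \<rho> where "\<rho> i = u i / w i" for i
  have \<rho>: "u i * w j = u j * w i \<longleftrightarrow> \<rho> i = \<rho> j" if "i \<in> ?Q" "j \<in> ?Q" for i j
    using that by (simp add: \<rho>_def field_simps)
  have u: "u i = \<rho> i * w i" if "i \<in> ?Q" for i using that by (simp add: \<rho>_def)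
  obtain q0 where q0: "q0 \<in> ?Q" using card_ge_3_avoid[OF card] by blast
  consider (A) p where "p \<in> B" "w p = 0" "u p \<noteq> 0"
    | (B3) "\<forall>l\<in>B. w l = 0 \<longrightarrow> u l = 0" "card ?Q = 3"
    | (B4) "\<forall>l\<in>B. w l = 0 \<longrightarrow> u l = 0" "card ?Q \<ge> 4"
    using card by force
  then show ?thesis
  proof cases
    \<comment> \<open>The row of \<open>p\<close> is independent of every row in \<open>?Q\<close>, so it is the exceptional one.\<close>
    case A
    have dep: "u p * w i \<noteq> u i * w p" if "i \<in> ?Q" for i using A that by simp
    have const: "\<rho> j = \<rho> q0" if j: "j \<in> ?Q" for j
    proof -
      obtain i where i: "i \<in> ?Q" "i \<noteq> j" "i \<noteq> q0" using card_ge_3_avoid[OF card] by blast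
      have "u j * w q0 = u q0 * w j"
        by (rule not_has_disjoint_basesD[OF ns dep[OF i(1)]]) (use A i j q0 in auto)
      then show ?thesis using \<rho>[OF j q0] by simp
    qed
    have zero: "u l = 0" if l: "l \<in> B" "w l = 0" "l \<noteq> p" for l
    proof -
      obtain i where i: "i \<in> ?Q" "i \<noteq> q0" using card_ge_3_avoid[OF card] by blast
      have "u l * w q0 = u q0 * w l"
        by (rule not_has_disjoint_basesD[OF ns dep[OF i(1)]]) (use A i l q0 in auto)
      then show ?thesis using l q0 by simp
    qed
    have "\<forall>i\<in>B - {p}. u i = \<rho> q0 * w i"
    proof
      fix i assume "i \<in> B - {p}"
      then show "u i = \<rho> q0 * w i"
        using const[of i] u[of i] zero[of i] by (cases "w i = 0") auto
    qed
    then show ?thesis using A(1) by blast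
  next
    case B3
    then obtain i j k where "?Q = {i, j, k}" "i \<noteq> j" "i \<noteq> k" "j \<noteq> k"
      by (auto simp: card_3_iff)
    then show ?thesis using B3(1) by blast
  next
    case B4
    have "\<exists>p\<in>B. \<exists>r. \<forall>i\<in>?Q - {p}. \<rho> i = r"
    proof (cases "\<forall>i\<in>?Q. \<rho> i = \<rho> q0")
      case True
      then show ?thesis using q0 by blast
    next
      case False
      then obtain i where i: "i \<in> ?Q" "\<rho> i \<noteq> \<rho> q0" by blast
      have neq: "u i * w q0 \<noteq> u q0 * w i" using \<rho>[OF i(1) q0] i(2) by simp
      obtain k where k: "k \<in> ?Q" "k \<noteq> i" "k \<noteq> q0" using card_ge_3_avoid[OF card] by blast
      obtain l where l: "l \<in> ?Q" "l \<noteq> i" "l \<noteq> q0" "l \<noteq> k" using card_ge_4_avoid[OF B4(2)] by blast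
      have const: "\<rho> m = \<rho> k" if m: "m \<in> ?Q" "m \<noteq> i" "m \<noteq> q0" for m
        using not_has_disjoint_basesD[OF ns neq, of m k] m k i q0 \<rho>[OF m(1) k(1)] by auto
      have "\<rho> i = \<rho> k \<or> \<rho> q0 = \<rho> k"
      proof (rule ccontr)
        assume "\<not> ?thesis"
        then have "u i * w k \<noteq> u k * w i" "u q0 * w l \<noteq> u l * w q0"
          using \<rho>[OF i(1) k(1)] \<rho>[OF q0 l(1)] const[OF l(1-3)] by auto
        then show False
          using not_has_disjoint_basesD[OF ns, of i k q0 l] i k l q0 by auto
      qed
      then show ?thesis
      proof
        assume "\<rho> i = \<rho> k"
        then have "\<forall>m\<in>?Q - {q0}. \<rho> m = \<rho> k" using const by blast
        then show ?thesis using q0 by blast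
      next
        assume "\<rho> q0 = \<rho> k"
        then have "\<forall>m\<in>?Q - {i}. \<rho> m = \<rho> k" using const by blast
        then show ?thesis using i by blast
      qed
    qed
    then obtain p r where p: "p \<in> B" "\<forall>i\<in>?Q - {p}. \<rho> i = r" by blast
    have "\<forall>i\<in>B - {p}. u i = r * w i"
    proof
      fix i assume "i \<in> B - {p}"
      then show "u i = r * w i"
        using p(2) u[of i] B4(1) by (cases "w i = 0") auto
    qed
    then show ?thesis using p(1) by blast
  qed
qed

text \<open>
Scaling \<open>u\<close> by \<open>sqrt t\<close> can be compensated by \<open>w\<close>, continuously in \<open>t\<close> near 1, in both cases of the
preceding lemma. If \<open>u i = r w i\<close> for all \<open>i \<noteq> p\<close>, then scaling these \<open>w i\<close> by a common \<open>s\<close> with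
\<open>s\<^sup>2 = 1 + r\<^sup>2 (1 - t)\<close> repairs their products, and the equations that involve \<open>p\<close> all reduce to a
single one for \<open>w p\<close>. If there are just three nonzero rows, then the three products that \<open>w\<close> has to
attain are close to products of nonzero numbers, and three numbers with prescribed pairwise products
\<open>P\<^sub>i\<^sub>j\<close>, \<open>P\<^sub>i\<^sub>k\<close>, \<open>P\<^sub>j\<^sub>k\<close> exist if \<open>P\<^sub>i\<^sub>j P\<^sub>i\<^sub>k / P\<^sub>j\<^sub>k\<close> is positive: this is the square of the first.
\<close>

lemma testlet_deformation:
  fixes u w :: "'a \<Rightarrow> real"
  assumes ns: "\<not> has_disjoint_bases B u w" and card: "card {i \<in> B. w i \<noteq> 0} \<ge> 3"
  shows "\<exists>w'. (\<forall>i\<in>B. ((\<lambda>t. w' t i) \<longlongrightarrow> w i) (at (1::real))) \<and>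
    (\<forall>\<^sub>F t in at 1. \<forall>i\<in>B. \<forall>j\<in>B. i \<noteq> j \<longrightarrow> t * (u i * u j) + w' t i * w' t j = u i * u j + w i * w j)"
  using no_disjoint_bases_structure[OF assms]
proof (elim disjE exE bexE conjE)
  fix p r assume p: "p \<in> B" and r: "\<forall>i\<in>B - {p}. u i = r * w i"
  define s where "s t = sqrt (1 + r\<^sup>2 * (1 - t))" for t
  define w' where "w' t i = (if i = p then (w p + u p * r * (1 - t)) / s t else s t * w i)" for t i
  have s_lim: "(s \<longlongrightarrow> 1) (at 1)"
    unfolding s_def by (auto intro!: tendsto_eq_intros)
  have "((\<lambda>t. 1 + r\<^sup>2 * (1 - t)) \<longlongrightarrow> 1) (at 1)"
    by (auto intro!: tendsto_eq_intros)
  then have pos: "\<forall>\<^sub>F t in at 1. 1 + r\<^sup>2 * (1 - t) > 0"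
    by (rule order_tendstoD) simp
  have lim: "((\<lambda>t. w' t i) \<longlongrightarrow> w i) (at 1)" for i
    unfolding w'_def using s_lim by (cases "i = p") (auto intro!: tendsto_eq_intros)
  moreover have "\<forall>\<^sub>F t in at 1. \<forall>i\<in>B. \<forall>j\<in>B. i \<noteq> j \<longrightarrow> t * (u i * u j) + w' t i * w' t j = u i * u j + w i * w j"
    using pos
  proof eventually_elim
    case (elim t)
    then have s: "s t > 0" "s t * s t = 1 + r\<^sup>2 * (1 - t)" by (simp_all add: s_def)
    have offp: "t * (u i * u j) + w' t i * w' t j = u i * u j + w i * w j"
      if "i \<in> B" "j \<in> B" "i \<noteq> p" "j \<noteq> p" for i j
    proof -
      have "t * (u i * u j) + w' t i * w' t j = (t * r\<^sup>2 + s t * s t) * (w i * w j)"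
        using that r by (simp add: w'_def algebra_simps power2_eq_square)
      also have "\<dots> = u i * u j + w i * w j"
        unfolding s(2) using that r by (simp add: algebra_simps power2_eq_square)
      finally show ?thesis .
    qed
    have withp: "t * (u p * u j) + w' t p * w' t j = u p * u j + w p * w j"
      if "j \<in> B" "j \<noteq> p" for j
    proof -
      have "w' t p * w' t j = (w p + u p * r * (1 - t)) * w j"
        using that s(1) by (simp add: w'_def)
      then show ?thesis using that r by (simp add: algebra_simps)
    qed
    show ?case
    proof (intro ballI impI)
      fix i j assume "i \<in> B" "j \<in> B" "i \<noteq> j"
      then show "t * (u i * u j) + w' t i * w' t j = u i * u j + w i * w j"
        using offp[of i j] withp[of i] withp[of j]
        by (cases "i = p"; cases "j = p") (simp_all add: mult.commute)
    qed
  qed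
  ultimately show ?thesis by blast
next
  fix i j k assume ne: "i \<noteq> j" "i \<noteq> k" "j \<noteq> k" and Q: "{i \<in> B. w i \<noteq> 0} = {i, j, k}"
    and zero: "\<forall>l\<in>B. w l = 0 \<longrightarrow> u l = 0"
  have nz: "w i \<noteq> 0" "w j \<noteq> 0" "w k \<noteq> 0" using Q by auto
  define P where "P a b t = w a * w b + (1 - t) * (u a * u b)" for a b and t :: real
  define v where "v t = sgn (w i) * sqrt (P i j t * P i k t / P j k t)" for t
  define w' where "w' t l = (if l = i then v t else if l = j then P i j t / v t else if l = k then P i k t / v t else 0)" for t l
  have P_lim: "(P a b \<longlongrightarrow> w a * w b) (at 1)" for a b
    unfolding P_def by (auto intro!: tendsto_eq_intros)
  have P_nz: "\<forall>\<^sub>F t in at 1. P a b t \<noteq> 0" if "w a \<noteq> 0" "w b \<noteq> 0" for a b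
    using tendsto_imp_eventually_ne[OF P_lim, of a b 0] that by simp
  have q_lim: "((\<lambda>t. P i j t * P i k t / P j k t) \<longlongrightarrow> (w i)\<^sup>2) (at 1)"
    using P_lim[of i j] P_lim[of i k] P_lim[of j k] nz
    by (auto intro!: tendsto_eq_intros simp: power2_eq_square)
  then have q_pos: "\<forall>\<^sub>F t in at 1. P i j t * P i k t / P j k t > 0"
    by (rule order_tendstoD) (use nz in simp)
  have "((\<lambda>t. sqrt (P i j t * P i k t / P j k t)) \<longlongrightarrow> \<bar>w i\<bar>) (at 1)"
    using tendsto_real_sqrt[OF q_lim] by simp
  then have "(v \<longlongrightarrow> sgn (w i) * \<bar>w i\<bar>) (at 1)"
    unfolding v_def by (intro tendsto_mult tendsto_const)
  then have v_lim: "(v \<longlongrightarrow> w i) (at 1)" by (simp add: sgn_mult_abs)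
  have "\<forall>l\<in>B. ((\<lambda>t. w' t l) \<longlongrightarrow> w l) (at 1)"
  proof
    fix l assume l: "l \<in> B"
    have "((\<lambda>t. P i m t / v t) \<longlongrightarrow> w m) (at 1)" for m
      using tendsto_divide[OF P_lim[of i m] v_lim] nz by simp
    then show "((\<lambda>t. w' t l) \<longlongrightarrow> w l) (at 1)"
      using l Q v_lim ne unfolding w'_def by (cases "l = i"; cases "l = j"; cases "l = k") auto
  qed
  moreover have "\<forall>\<^sub>F t in at 1. \<forall>a\<in>B. \<forall>b\<in>B. a \<noteq> b \<longrightarrow> t * (u a * u b) + w' t a * w' t b = u a * u b + w a * w b"
    using q_pos P_nz[OF nz(1,2)] P_nz[OF nz(1,3)] P_nz[OF nz(2,3)]
  proof eventually_elim
    case (elim t)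
    have vv: "v t * v t = P i j t * P i k t / P j k t"
    proof -
      have "sgn (w i) * sgn (w i) = 1" using nz by (simp add: sgn_if)
      then have "v t * v t = sqrt (P i j t * P i k t / P j k t) * sqrt (P i j t * P i k t / P j k t)"
        unfolding v_def by (simp only: mult_ac mult_1_left mult_1_right) (simp only: mult.assoc[symmetric] mult_1_left)
      also have "\<dots> = P i j t * P i k t / P j k t"
        using elim(1) by (simp only: real_sqrt_mult_self abs_of_pos)
      finally show ?thesis .
    qed
    then have v0: "v t \<noteq> 0" using elim by auto
    have ij: "w' t i * w' t j = P i j t" "w' t i * w' t k = P i k t"
      using v0 ne by (simp_all add: w'_def)
    have jk: "w' t j * w' t k = P j k t"
      using vv elim ne by (simp add: w'_def)
    have w0: "w' t l = 0" "u l = 0" "w l = 0" if "l \<in> B" "l \<notin> {i, j, k}" for l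
      using that zero Q by (auto simp: w'_def)
    show ?case
    proof (intro ballI impI)
      fix a b assume ab: "a \<in> B" "b \<in> B" "a \<noteq> b"
      show "t * (u a * u b) + w' t a * w' t b = u a * u b + w a * w b"
      proof (cases "a \<in> {i, j, k} \<and> b \<in> {i, j, k}")
        case True
        then have "w' t a * w' t b = P a b t"
          using ij jk ab(3) by (auto simp: P_def mult.commute)
        then show ?thesis by (simp add: P_def algebra_simps)
      next
        case False
        then show ?thesis using w0[of a] w0[of b] ab by auto
      qed
    qed
  qed
  ultimately show ?thesis by blast
qed

text \<open>
Near \<open>t = 1\<close> the deformed rows stay inside the open unit disc, as finitely many strict inequalities
survive small perturbations.
\<close>

lemma testlet_deformation_bounded:
  fixes u w :: "'a \<Rightarrow> real"
  assumes fin: "finite B" and ns: "\<not> has_disjoint_bases B u w" and card: "card {i \<in> B. w i \<noteq> 0} \<ge> 3"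
    and less_1: "\<And>i. i \<in> B \<Longrightarrow> (u i)\<^sup>2 + (w i)\<^sup>2 < 1"
  shows "\<exists>w'. \<forall>\<^sub>F t in at (1::real). (\<forall>i\<in>B. t * (u i)\<^sup>2 + (w' t i)\<^sup>2 < 1) \<and>
    (\<forall>i\<in>B. \<forall>j\<in>B. i \<noteq> j \<longrightarrow> t * (u i * u j) + w' t i * w' t j = u i * u j + w i * w j)"
proof -
  obtain w' where lim: "\<forall>i\<in>B. ((\<lambda>t. w' t i) \<longlongrightarrow> w i) (at (1::real))"
    and prods: "\<forall>\<^sub>F t in at 1. \<forall>i\<in>B. \<forall>j\<in>B. i \<noteq> j \<longrightarrow> t * (u i * u j) + w' t i * w' t j = u i * u j + w i * w j"
    using testlet_deformation[OF ns card] by blast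
  have "\<forall>\<^sub>F t in at 1. \<forall>i\<in>B. t * (u i)\<^sup>2 + (w' t i)\<^sup>2 < 1"
  proof (rule eventually_ball_finite[OF fin], rule ballI)
    fix i assume i: "i \<in> B"
    have "((\<lambda>t. t * (u i)\<^sup>2 + (w' t i)\<^sup>2) \<longlongrightarrow> 1 * (u i)\<^sup>2 + (w i)\<^sup>2) (at 1)"
      using bspec[OF lim i] by (intro tendsto_intros)
    then show "\<forall>\<^sub>F t in at 1. t * (u i)\<^sup>2 + (w' t i)\<^sup>2 < 1"
      by (rule order_tendstoD) (use less_1[OF i] in simp)
  qed
  then show ?thesis using prods by (auto intro!: exI[of _ w'] eventually_conj)
qed

section \<open>Ranks of two-column blocks\<close>

text \<open>
If all minors vanish, then a nonzero row \<open>(x, y)\<close> yields the relation \<open>(y, -x)\<close> between the columns; if some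
minor is nonzero, a relation between the columns is trivial by Cramer's rule. The rank counts the set of columns, so equal
columns have to be excluded separately.
\<close>

lemma mat_rank_two_columns_iff:
  fixes M :: "real mat"
  assumes M: "M \<in> carrier_mat n 2"
  shows "mat_rank M = 2 \<longleftrightarrow> (\<exists>i<n. \<exists>j<n. M $$ (i, 0) * M $$ (j, 1) \<noteq> M $$ (j, 0) * M $$ (i, 1))"
proof -
  interpret vec_space "TYPE(real)" n .
  have rank: "mat_rank M = rank M" using M by (simp add: mat_rank_def)
  have mv: "(M *\<^sub>v v) $ i = M $$ (i, 0) * v $ 0 + M $$ (i, 1) * v $ 1"
    if "v \<in> carrier_vec 2" "i < n" for v i
    using M that by (simp add: scalar_prod_def numeral_2_eq_2)
  show ?thesis
  proof
    assume "mat_rank M = 2"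
    then have r: "rank M = 2" using rank by simp
    have dist: "distinct (cols M)"
    proof (rule ccontr)
      assume "\<not> distinct (cols M)"
      then have "card (set (cols M)) < 2"
        using card_distinct[of "cols M"] card_length[of "cols M"] M by (metis carrier_matD(2) cols_length le_neq_implies_less)
      obtain S where S: "maximal S (\<lambda>T. T \<subseteq> set (cols M) \<and> lin_indpt T)"
        using maximal_exists_superset[of "set (cols M)" "\<lambda>T. T \<subseteq> set (cols M) \<and> lin_indpt T" "{}"]
        by (auto simp: finite_lin_indpt2)
      then have "S \<subseteq> set (cols M)" by (simp add: maximal_def)
      then have "card S \<le> card (set (cols M))" by (intro card_mono) auto
      then show False
        using rank_card_indpt[OF M S] r \<open>card (set (cols M)) < 2\<close> by simp
    qed
    show "\<exists>i<n. \<exists>j<n. M $$ (i, 0) * M $$ (j, 1) \<noteq> M $$ (j, 0) * M $$ (i, 1)"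
    proof (rule ccontr)
      assume "\<not> ?thesis"
      then have dep: "M $$ (i, 0) * M $$ (j, 1) = M $$ (j, 0) * M $$ (i, 1)" if "i < n" "j < n" for i j
        using that by blast
      have "\<exists>i<n. M $$ (i, 0) \<noteq> 0 \<or> M $$ (i, 1) \<noteq> 0"
      proof (rule ccontr)
        assume "\<not> ?thesis"
        then have "col M 0 = col M 1" using M by (intro eq_vecI) auto
        then show False using dist M by (simp add: distinct_conv_nth)
      qed
      then obtain i where i: "i < n" "M $$ (i, 0) \<noteq> 0 \<or> M $$ (i, 1) \<noteq> 0" by blast
      define v where "v = vec 2 (\<lambda>k. if k = 0 then M $$ (i, 1) else - M $$ (i, 0))"
      have v: "v \<in> carrier_vec 2" "v $ 0 = M $$ (i, 1)" "v $ 1 = - M $$ (i, 0)" by (simp_all add: v_def)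
      have "v \<noteq> 0\<^sub>v 2"
      proof
        assume "v = 0\<^sub>v 2"
        then have "v $ 0 = 0" "v $ 1 = 0" by simp_all
        then show False using v i(2) by simp
      qed
      moreover have "M *\<^sub>v v = 0\<^sub>v n"
        using M mv[OF v(1)] v dep[OF i(1)] by (intro eq_vecI) (simp_all add: mult.commute)
      ultimately have "lin_dep (set (cols M))"
        by (rule lin_depI[OF M v(1) _ _ dist])
      then show False using full_rank_lin_indpt[OF M r dist] by blast
    qed
  next
    assume "\<exists>i<n. \<exists>j<n. M $$ (i, 0) * M $$ (j, 1) \<noteq> M $$ (j, 0) * M $$ (i, 1)"
    then obtain i j where ij: "i < n" "j < n" "M $$ (i, 0) * M $$ (j, 1) \<noteq> M $$ (j, 0) * M $$ (i, 1)" by blast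
    have dist: "distinct (cols M)"
    proof -
      have "col M 0 \<noteq> col M 1"
      proof
        assume eq: "col M 0 = col M 1"
        have "M $$ (k, 0) = M $$ (k, 1)" if "k < n" for k
          using arg_cong[OF eq, of "\<lambda>c. c $ k"] M that by simp
        then show False using ij by simp
      qed
      moreover have "cols M = [col M 0, col M 1]"
        using M by (simp add: cols_def numeral_2_eq_2)
      ultimately show ?thesis by simp
    qed
    have "lin_indpt (set (cols M))"
    proof (rule ccontr)
      assume "\<not> ?thesis"
      then obtain v where v: "v \<in> carrier_vec 2" "v \<noteq> 0\<^sub>v 2" "M *\<^sub>v v = 0\<^sub>v n"
        using lin_depE[OF M _ dist] by blast
      have row: "M $$ (k, 0) * v $ 0 + M $$ (k, 1) * v $ 1 = 0" if "k < n" for k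
        using mv[OF v(1) that] v(3) that by simp
      have cramer: "(a * d - c * b) * x = 0" "(a * d - c * b) * y = 0"
        if "a * x + b * y = 0" "c * x + d * y = 0" for a b c d x y :: real
      proof -
        have "(a * d - c * b) * x = d * (a * x + b * y) - b * (c * x + d * y)"
          "(a * d - c * b) * y = a * (c * x + d * y) - c * (a * x + b * y)"
          by (simp_all add: algebra_simps)
        then show "(a * d - c * b) * x = 0" "(a * d - c * b) * y = 0" by (simp_all only: that mult_zero_right diff_0_right)
      qed
      note cramer[OF row[OF ij(1)] row[OF ij(2)]]
      then have "v $ 0 = 0" "v $ 1 = 0" using ij(3) by simp_all
      then have "v = 0\<^sub>v 2" using v(1) by (intro eq_vecI) (auto simp: less_2_cases_iff)
      then show False using v(2) by simp
    qed
    then show "mat_rank M = 2" using lin_indpt_full_rank[OF M dist] rank by simp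
  qed
qed

text \<open>
Submatrices are indexed by ranks within the selected sets of rows and columns; the map \<open>i \<mapsto> card {a \<in> B. a < i}\<close>
translates the rows back to elements of \<open>B\<close>.
\<close>

lemma mat_rank_testlet_block_iff:
  fixes A :: "real mat"
  assumes A: "A \<in> carrier_mat J (1 + G)" and g: "1 \<le> g" "g \<le> G" and B: "B \<subseteq> {..<J}"
  shows "mat_rank (submatrix A B {0, g}) = 2 \<longleftrightarrow>
    (\<exists>i\<in>B. \<exists>j\<in>B. A $$ (i, 0) * A $$ (j, g) \<noteq> A $$ (j, 0) * A $$ (i, g))"
proof -
  let ?M = "submatrix A B {0, g}"
  have rows: "{i. i < dim_row A \<and> i \<in> B} = B" using A B by auto
  have cols: "{j. j < dim_col A \<and> j \<in> {0, g}} = {0, g}" using A g by auto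
  have M: "?M \<in> carrier_mat (card B) 2"
    using g by (intro carrier_matI) (simp_all only: dim_submatrix rows cols, auto)
  have c0: "card {a \<in> {0, g}. a < 0} = 0" by simp
  have "{a \<in> {0, g}. a < g} = {0}" using g by auto
  then have cg: "card {a \<in> {0, g}. a < g} = 1" by simp
  have idx: "?M $$ (card {a \<in> B. a < i}, 0) = A $$ (i, 0)" "?M $$ (card {a \<in> B. a < i}, 1) = A $$ (i, g)"
    if "i \<in> B" for i
  proof -
    have "i < dim_row A" "0 < dim_col A" "g < dim_col A" using that A B g by auto
    then show "?M $$ (card {a \<in> B. a < i}, 0) = A $$ (i, 0)" "?M $$ (card {a \<in> B. a < i}, 1) = A $$ (i, g)"
      using submatrix_index_card[of i A 0 B "{0, g}"] submatrix_index_card[of i A g B "{0, g}"] that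
      unfolding c0 cg by auto
  qed
  have finB: "finite B" using B finite_subset by blast
  have bij: "(\<lambda>i. card {a \<in> B. a < i}) ` B = {..<card B}"
  proof -
    have lt: "card {a \<in> B. a < i} < card B" if "i \<in> B" for i
      using finB that by (intro psubset_card_mono) auto
    have "inj_on (\<lambda>i. card {a \<in> B. a < i}) B"
    proof (rule linorder_inj_onI')
      fix i j assume "i \<in> B" "j \<in> B" "i < j"
      then have "card {a \<in> B. a < i} < card {a \<in> B. a < j}"
        using finB by (intro psubset_card_mono) auto
      then show "card {a \<in> B. a < i} \<noteq> card {a \<in> B. a < j}" by simp
    qed
    then have "card ((\<lambda>i. card {a \<in> B. a < i}) ` B) = card B" by (rule card_image)
    then show ?thesis using lt by (intro card_subset_eq) auto
  qed
  have "mat_rank ?M = 2 \<longleftrightarrow> (\<exists>i\<in>{..<card B}. \<exists>j\<in>{..<card B}. ?M $$ (i, 0) * ?M $$ (j, 1) \<noteq> ?M $$ (j, 0) * ?M $$ (i, 1))"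
    unfolding mat_rank_two_columns_iff[OF M] by blast
  also have "\<dots> \<longleftrightarrow> (\<exists>i\<in>B. \<exists>j\<in>B. A $$ (i, 0) * A $$ (j, g) \<noteq> A $$ (j, 0) * A $$ (i, g))"
    unfolding bij[symmetric] using idx by simp
  finally show ?thesis .
qed

lemma Q_set_eq:
  assumes ps: "(A, d) \<in> parameter_space J G testlet" and g: "g \<in> {1..G}"
  shows "Q_set J A g = {j \<in> testlet_items J testlet g. std_testlet testlet A j \<noteq> 0}"
proof -
  have "item_sd testlet A j \<noteq> 0" for j using item_sd_pos[of testlet A j] by simp
  then have nz: "std_testlet testlet A j \<noteq> 0 \<longleftrightarrow> A $$ (j, testlet j) \<noteq> 0" for j
    by (simp add: std_testlet_def)
  have "\<forall>j<J. \<forall>g\<in>{1..G}. g \<noteq> testlet j \<longrightarrow> A $$ (j, g) = 0"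
    using ps unfolding parameter_space_iff by (elim conjE)
  then have same_testlet: "testlet j = g" if "j < J" "A $$ (j, g) \<noteq> 0" for j
    using g that by metis
  show ?thesis
    unfolding Q_set_def testlet_items_def nz
  proof (rule equalityI; rule subsetI)
    fix j assume "j \<in> {j \<in> {..<J}. A $$ (j, g) \<noteq> 0}"
    then show "j \<in> {j \<in> {j \<in> {..<J}. testlet j = g}. A $$ (j, testlet j) \<noteq> 0}"
      using same_testlet[of j] by simp
  qed auto
qed

lemma mem_H1_set_iff:
  "g \<in> H1_set J G testlet A \<longleftrightarrow> g \<in> {1..G} \<and> (\<exists>j\<in>testlet_items J testlet g. std_main testlet A j \<noteq> 0)"
proof -
  have "item_sd testlet A j \<noteq> 0" for j using item_sd_pos[of testlet A j] by simp
  then show ?thesis by (simp add: H1_set_def std_main_def)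
qed

text \<open>
Two rows of full rank in each block of the partition suffice, and any set of rows that contains
two independent ones has full rank. Hence the blocks may be taken to be a pair and its complement.
\<close>

lemma mem_H2_set_iff:
  assumes ps: "(A, d) \<in> parameter_space J G testlet"
  shows "g \<in> H2_set J G testlet A \<longleftrightarrow> g \<in> {1..G} \<and>
    has_disjoint_bases (testlet_items J testlet g) (std_main testlet A) (std_testlet testlet A)"
proof (cases "g \<in> {1..G}")
  case True
  let ?B = "testlet_items J testlet g" and ?b = "std_main testlet A" and ?w = "std_testlet testlet A"
  have A: "A \<in> carrier_mat J (1 + G)" using ps by (simp add: parameter_space_iff)
  have minor: "A $$ (i, 0) * A $$ (j, g) \<noteq> A $$ (j, 0) * A $$ (i, g) \<longleftrightarrow> ?b i * ?w j \<noteq> ?b j * ?w i"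
    if "i \<in> ?B" "j \<in> ?B" for i j
  proof -
    have "testlet i = g" "testlet j = g" using that by (simp_all add: testlet_items_def)
    then show ?thesis
      using item_sd_pos[of testlet A i] item_sd_pos[of testlet A j]
      by (simp add: std_main_def std_testlet_def) (simp add: mult.commute)
  qed
  have rank: "mat_rank (submatrix A S {0, g}) = 2 \<longleftrightarrow> (\<exists>i\<in>S. \<exists>j\<in>S. ?b i * ?w j \<noteq> ?b j * ?w i)"
    if S: "S \<subseteq> ?B" for S
  proof -
    have "S \<subseteq> {..<J}" using S by (auto simp: testlet_items_def)
    then have "mat_rank (submatrix A S {0, g}) = 2 \<longleftrightarrow>
        (\<exists>i\<in>S. \<exists>j\<in>S. A $$ (i, 0) * A $$ (j, g) \<noteq> A $$ (j, 0) * A $$ (i, g))"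
      using True by (intro mat_rank_testlet_block_iff[OF A]) auto
    then show ?thesis using minor S by blast
  qed
  show ?thesis
  proof
    assume "g \<in> H2_set J G testlet A"
    then obtain B1 B2 where B: "B1 \<union> B2 = ?B" "B1 \<inter> B2 = {}"
      "mat_rank (submatrix A B1 {0, g}) = 2" "mat_rank (submatrix A B2 {0, g}) = 2"
      unfolding H2_set_def by blast
    then have sub: "B1 \<subseteq> ?B" "B2 \<subseteq> ?B" by auto
    obtain i j where ij: "i \<in> B1" "j \<in> B1" "?b i * ?w j \<noteq> ?b j * ?w i"
      using B(3) rank[OF sub(1)] by blast
    obtain k l where kl: "k \<in> B2" "l \<in> B2" "?b k * ?w l \<noteq> ?b l * ?w k"
      using B(4) rank[OF sub(2)] by blast
    have "{i, j} \<inter> {k, l} = {}" using ij kl B(2) by auto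
    then have "has_disjoint_bases ?B ?b ?w"
      using ij kl sub by (intro has_disjoint_basesI[of i _ j k l]) (auto simp only: subset_iff)
    then show "g \<in> {1..G} \<and> has_disjoint_bases ?B ?b ?w" using True by blast
  next
    assume "g \<in> {1..G} \<and> has_disjoint_bases ?B ?b ?w"
    then obtain i j k l where ijkl: "i \<in> ?B" "j \<in> ?B" "k \<in> ?B" "l \<in> ?B" "{i, j} \<inter> {k, l} = {}"
      "?b i * ?w j \<noteq> ?b j * ?w i" "?b k * ?w l \<noteq> ?b l * ?w k"
      unfolding has_disjoint_bases_def by blast
    have "mat_rank (submatrix A {i, j} {0, g}) = 2"
      using ijkl by (subst rank) blast+
    moreover have "mat_rank (submatrix A (?B - {i, j}) {0, g}) = 2"
      using ijkl by (subst rank) blast+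
    moreover have "{i, j} \<union> (?B - {i, j}) = ?B" "{i, j} \<inter> (?B - {i, j}) = {}"
      using ijkl by auto
    ultimately show "g \<in> H2_set J G testlet A"
      unfolding H2_set_def using True by blast
  qed
next
  case False
  then show ?thesis by (auto simp: H2_set_def)
qed

section \<open>Sufficiency\<close>

text \<open>
Subtracting the main contribution, which is insensitive to a global sign, leaves the products of the
testlet loadings of distinct items.
\<close>

lemma testlet_loadings_determined_up_to_sign:
  assumes corr: "\<And>i j. i < J \<Longrightarrow> j < J \<Longrightarrow> i \<noteq> j \<Longrightarrow> item_corr testlet b' w' i j = item_corr testlet b w i j"
    and main: "\<exists>\<epsilon>\<in>{1, -1}. \<forall>j\<in>{..<J}. b' j = \<epsilon> * b j"
    and card: "card {j \<in> testlet_items J testlet g. w j \<noteq> 0} \<ge> 3"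
  shows "\<exists>\<epsilon>\<in>{1, -1}. \<forall>j\<in>testlet_items J testlet g. w' j = \<epsilon> * w j"
proof -
  let ?Q = "{j \<in> testlet_items J testlet g. w j \<noteq> 0}"
  obtain i where i: "i \<in> ?Q" using card_ge_3_avoid[OF card] by blast
  obtain j where j: "j \<in> ?Q" "j \<noteq> i" using card_ge_3_avoid[OF card, of i i] by blast
  obtain k where k: "k \<in> ?Q" "k \<noteq> i" "k \<noteq> j" using card_ge_3_avoid[OF card, of i j] by blast
  obtain \<epsilon> where \<epsilon>: "\<epsilon> \<in> {1, -1}" "\<forall>j\<in>{..<J}. b' j = \<epsilon> * b j" using main by blast
  have "w' i * w' j = w i * w j"
    if "i \<in> testlet_items J testlet g" "j \<in> testlet_items J testlet g" "id i \<noteq> id j" for i j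
  proof -
    have ij: "i < J" "j < J" "i \<noteq> j" "testlet i = testlet j" using that by (auto simp: testlet_items_def)
    have "b' i * b' j = b i * b j" using \<epsilon> ij(1,2) by auto
    then show ?thesis using corr[OF ij(1-3)] ij(4) by (simp add: item_corr_def)
  qed
  then show ?thesis
    by (rule rank_one_products_determine_up_to_sign[where lab = id and i = i and j = j and k = k])
       (use i j k in auto)
qed

lemma main_loadings_determined_three_testlets:
  assumes corr: "\<And>i j. i < J \<Longrightarrow> j < J \<Longrightarrow> i \<noteq> j \<Longrightarrow> item_corr testlet b' w' i j = item_corr testlet b w i j"
    and ijk: "i < J" "j < J" "k < J" "testlet i \<noteq> testlet j" "testlet i \<noteq> testlet k" "testlet j \<noteq> testlet k"
      "b i \<noteq> 0" "b j \<noteq> 0" "b k \<noteq> 0"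
  shows "\<exists>\<epsilon>\<in>{1, -1}. \<forall>j\<in>{..<J}. b' j = \<epsilon> * b j"
proof (rule rank_one_products_determine_up_to_sign[where lab = testlet and i = i and j = j and k = k])
  show "b' x * b' y = b x * b y" if "x \<in> {..<J}" "y \<in> {..<J}" "testlet x \<noteq> testlet y" for x y
    using corr[of x y] that by (auto simp: item_corr_def)
qed (use ijk in auto)

text \<open>
The products with the nonzero loading \<open>b m\<close> outside testlet \<open>g\<close> show that \<open>b'\<close> is a multiple \<open>c b\<close> of \<open>b\<close>
inside \<open>g\<close>, and \<open>b / c\<close> outside. Inside \<open>g\<close> the numbers \<open>D x y\<close> are products \<open>w' x * w' y\<close>, so
their \<open>2 \<times> 2\<close> minors with disjoint rows and columns vanish, while the minor belonging to the two
disjoint bases is \<open>1 - c\<^sup>2\<close> times the product of two nonzero determinants.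
\<close>

lemma main_loadings_determined_two_testlets:
  assumes corr: "\<And>i j. i < J \<Longrightarrow> j < J \<Longrightarrow> i \<noteq> j \<Longrightarrow> item_corr testlet b' w' i j = item_corr testlet b w i j"
    and split: "has_disjoint_bases (testlet_items J testlet g) b w"
    and m: "m < J" "testlet m \<noteq> g" "b m \<noteq> 0"
  shows "\<exists>\<epsilon>\<in>{1, -1}. \<forall>j\<in>{..<J}. b' j = \<epsilon> * b j"
proof -
  obtain i j k l where ijkl: "i \<in> testlet_items J testlet g" "j \<in> testlet_items J testlet g"
      "k \<in> testlet_items J testlet g" "l \<in> testlet_items J testlet g" "{i, j} \<inter> {k, l} = {}"
      "b i * w j \<noteq> b j * w i" "b k * w l \<noteq> b l * w k"
    using split unfolding has_disjoint_bases_def by blast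
  obtain p where p: "p < J" "testlet p = g" "b p \<noteq> 0"
    using ijkl by (cases "b i = 0") (auto simp: testlet_items_def)
  have cross: "b' x * b' y = b x * b y" if "x < J" "y < J" "testlet x \<noteq> testlet y" for x y
    using corr[of x y] that by (auto simp: item_corr_def)
  have "b' p * b' m = b p * b m" using cross p m by simp
  then have m': "b' m \<noteq> 0" using p m by auto
  define c where "c = b m / b' m"
  have c0: "c \<noteq> 0" using m m' by (simp add: c_def)
  have inside: "b' x = c * b x" if "x < J" "testlet x = g" for x
    using cross[of x m] that m m' by (simp add: c_def field_simps)
  have outside: "c * b' y = b y" if "y < J" "testlet y \<noteq> g" for y
    using cross[of p y] that p inside[of p] by simp
  define D where "D x y = (1 - c\<^sup>2) * (b x * b y) + w x * w y" for x y
  have D: "w' x * w' y = D x y" if "x \<in> testlet_items J testlet g" "y \<in> testlet_items J testlet g" "x \<noteq> y" for x y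
    using corr[of x y] that inside[of x] inside[of y]
    by (simp add: D_def item_corr_def testlet_items_def algebra_simps power2_eq_square)
  have "D i k * D j l = D i l * D j k"
  proof -
    have ne: "i \<noteq> k" "j \<noteq> l" "i \<noteq> l" "j \<noteq> k" using ijkl(5) by auto
    have "(w' i * w' k) * (w' j * w' l) = (w' i * w' l) * (w' j * w' k)" by (simp only: mult_ac)
    then show ?thesis
      unfolding D[OF ijkl(1,3) ne(1)] D[OF ijkl(2,4) ne(2)] D[OF ijkl(1,4) ne(3)] D[OF ijkl(2,3) ne(4)] .
  qed
  moreover have "D i k * D j l - D i l * D j k = (1 - c\<^sup>2) * ((b i * w j - b j * w i) * (b k * w l - b l * w k))"
    by (simp add: D_def algebra_simps)
  ultimately have "1 - c\<^sup>2 = 0" using ijkl(6,7) by simp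
  then have "c\<^sup>2 = 1" by simp
  then have c: "c \<in> {1, -1}" "c * c = 1" by (auto simp: power2_eq_1_iff)
  have "b' y = c * b y" if "y < J" for y
  proof (cases "testlet y = g")
    case False
    then have "c * (c * b' y) = c * b y" using outside[OF that] by simp
    then show ?thesis using c(2) by (simp add: mult.assoc[symmetric])
  qed (use inside that in blast)
  then show ?thesis using c(1) by blast
qed

section \<open>Necessity\<close>

text \<open>
Every testlet loading can be strictly enlarged while its row stays inside the open unit disc.
\<close>

lemma loading_room:
  fixes b w :: real
  assumes "b\<^sup>2 + w\<^sup>2 < 1"
  obtains z where "z > \<bar>w\<bar>" "b\<^sup>2 + z\<^sup>2 < 1"
proof -
  \<comment> \<open>Any number whose square lies strictly between \<open>w\<^sup>2\<close> and \<open>1 - b\<^sup>2\<close> would do; take the midpoint.\<close>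
  define z where "z = sqrt ((w\<^sup>2 + (1 - b\<^sup>2)) / 2)"
  have "w\<^sup>2 < (w\<^sup>2 + (1 - b\<^sup>2)) / 2" using assms by simp
  then have "sqrt (w\<^sup>2) < z" unfolding z_def by (rule real_sqrt_less_mono)
  then have "z > \<bar>w\<bar>" by simp
  moreover have "z\<^sup>2 = (w\<^sup>2 + (1 - b\<^sup>2)) / 2"
    using \<open>w\<^sup>2 < _\<close> zero_le_power2[of w] unfolding z_def by (intro real_sqrt_pow2) linarith
  then have "b\<^sup>2 + z\<^sup>2 < 1" using assms by simp
  ultimately show ?thesis using that by blast
qed

text \<open>
If all testlet loadings of \<open>g\<close> but one vanish, that one contributes to no product of distinct items
and can be enlarged, even if it is 0. If exactly two are nonzero, only their product matters, so one is enlarged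
and the other shrunk by the same factor.
\<close>

lemma not_identifiable_few_testlet_loadings:
  assumes ta: "testlet_assignment J G testlet" and ps: "(A, d) \<in> parameter_space J G testlet"
    and g: "g \<in> {1..G}" and few: "card {j \<in> testlet_items J testlet g. std_testlet testlet A j \<noteq> 0} < 3"
  shows "\<not> identifiable_at J G testlet A d"
proof -
  let ?b = "std_main testlet A" and ?w = "std_testlet testlet A" and ?B = "testlet_items J testlet g"
  let ?Q = "{j \<in> ?B. ?w j \<noteq> 0}"
  have fin: "finite ?Q" by (simp add: testlet_items_def)
  note less_1 = std_norm_less_1[of testlet A]
  have "g \<in> testlet ` {..<J}" using ta g by (simp add: testlet_assignment_def)
  then have ne: "?B \<noteq> {}" by (auto simp: testlet_items_def)
  consider (one) p where "p \<in> ?B" "\<And>i. i \<in> ?B \<Longrightarrow> i \<noteq> p \<Longrightarrow> ?w i = 0"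
    | (two) p q where "p \<noteq> q" "?Q = {p, q}"
  proof (cases "card ?Q = 2")
    case True
    then show ?thesis using that(2) by (auto simp: card_2_iff)
  next
    case False
    then have "card ?Q \<le> Suc 0" using few by simp
    then have eq: "x = y" if "x \<in> ?Q" "y \<in> ?Q" for x y
      using that fin by (simp only: card_le_Suc0_iff_eq)
    show ?thesis
    proof (cases "?Q = {}")
      case True
      then show ?thesis using that(1) ne by blast
    next
      case False
      then obtain p where "p \<in> ?Q" by blast
      then show ?thesis using that(1)[of p] eq by blast
    qed
  qed
  then show ?thesis
  proof cases
    case one
    obtain z where z: "z > \<bar>?w p\<bar>" "(?b p)\<^sup>2 + z\<^sup>2 < 1" using loading_room[OF less_1[of p]] by blast
    show ?thesis
    proof (rule not_identifiableI[OF ta ps, where b = ?b and w = "?w(p := z)" and p = p])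
      show "(?b j)\<^sup>2 + ((?w(p := z)) j)\<^sup>2 < 1" for j using z less_1[of j] by simp
      show "item_corr testlet ?b (?w(p := z)) i j = item_corr testlet ?b ?w i j"
        if "i < J" "j < J" "i \<noteq> j" for i j
        using that one by (auto simp: item_corr_def testlet_items_def)
    qed (use one z in \<open>auto simp: testlet_items_def\<close>)
  next
    case two
    then have pq: "p \<in> ?Q" "q \<in> ?Q" by auto
    obtain z where z: "z > \<bar>?w p\<bar>" "(?b p)\<^sup>2 + z\<^sup>2 < 1" using loading_room[OF less_1[of p]] by blast
    define w' where "w' = ?w(p := z, q := ?w p * ?w q / z)"
    have "\<bar>?w p * ?w q / z\<bar> \<le> \<bar>?w q\<bar>"
    proof -
      have "\<bar>?w p\<bar> * \<bar>?w q\<bar> \<le> z * \<bar>?w q\<bar>" using z by (intro mult_right_mono) auto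
      then show ?thesis using z by (simp add: abs_mult field_simps)
    qed
    then have q: "(?w p * ?w q / z)\<^sup>2 \<le> (?w q)\<^sup>2" by (simp only: abs_le_square_iff)
    show ?thesis
    proof (rule not_identifiableI[OF ta ps, where b = ?b and w = w' and p = p])
      show "(?b j)\<^sup>2 + (w' j)\<^sup>2 < 1" for j
        using z less_1[of j] q two(1) by (auto simp: w'_def)
      have prod: "w' i * w' j = ?w i * ?w j" if "i \<in> ?B" "j \<in> ?B" "i \<noteq> j" for i j
      proof -
        have "?w i = 0" if "i \<notin> {p, q}" "i \<in> ?B" for i using that two(2) by blast
        then show ?thesis using that two(1) z(1) by (auto simp: w'_def)
      qed
      show "item_corr testlet ?b w' i j = item_corr testlet ?b ?w i j"
        if "i < J" "j < J" "i \<noteq> j" for i j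
      proof (cases "testlet i = g")
        case True
        then show ?thesis using that prod[of i j] by (auto simp: item_corr_def testlet_items_def)
      next
        case False
        then show ?thesis using that pq by (auto simp: item_corr_def testlet_items_def w'_def)
      qed
    qed (use pq two(1) z in \<open>auto simp: testlet_items_def w'_def\<close>)
  qed
qed

text \<open>
A single nonzero main loading does not contribute to any product of distinct items.
\<close>

lemma not_identifiable_no_main_loading:
  assumes ta: "testlet_assignment J G testlet" and ps: "(A, d) \<in> parameter_space J G testlet"
    and J: "0 < J" and zero: "\<And>j. j < J \<Longrightarrow> std_main testlet A j = 0"
  shows "\<not> identifiable_at J G testlet A d"
proof -
  let ?b = "std_main testlet A" and ?w = "std_testlet testlet A"
  have "(?w 0)\<^sup>2 + (0::real)\<^sup>2 < 1" using std_norm_less_1[of testlet A 0] zero[OF J] by simp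
  then obtain z where z: "z > \<bar>0::real\<bar>" "(?w 0)\<^sup>2 + z\<^sup>2 < 1" by (rule loading_room)
  show ?thesis
  proof (rule not_identifiableI[OF ta ps, where b = "?b(0 := z)" and w = ?w and p = 0])
    show "((?b(0 := z)) j)\<^sup>2 + (?w j)\<^sup>2 < 1" for j
      using z std_norm_less_1[of testlet A j] by (simp add: add.commute)
  qed (use z J zero in \<open>auto simp: item_corr_def\<close>)
qed

text \<open>
The correlations inside testlet \<open>g\<close> are inner products of the rows \<open>(b j, w j)\<close>, which a common rotation
preserves; the correlations across testlets remain 0. The rotation is chosen to move the row of \<open>p\<close>, whose
main loading is nonzero, onto the testlet axis. This changes the main loading in absolute value.
\<close>

lemma not_identifiable_one_main_testlet:
  assumes ta: "testlet_assignment J G testlet" and ps: "(A, d) \<in> parameter_space J G testlet"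
    and zero: "\<And>j. j < J \<Longrightarrow> testlet j \<noteq> g \<Longrightarrow> std_main testlet A j = 0"
    and p: "p < J" "testlet p = g" "std_main testlet A p \<noteq> 0"
  shows "\<not> identifiable_at J G testlet A d"
proof -
  let ?b = "std_main testlet A" and ?w = "std_testlet testlet A"
  define n where "n = sqrt ((?b p)\<^sup>2 + (?w p)\<^sup>2)"
  define c s where "c = ?w p / n" and "s = ?b p / n"
  have "n > 0" using p(3) by (simp add: n_def add_pos_nonneg)
  have cs: "c * c + s * s = 1"
  proof -
    have "n * n = ?b p * ?b p + ?w p * ?w p" by (simp add: n_def flip: power2_eq_square)
    moreover have "c * c + s * s = (?b p * ?b p + ?w p * ?w p) / (n * n)"
      by (simp add: c_def s_def add_divide_distrib)
    ultimately show ?thesis using \<open>n > 0\<close> by (metis divide_self less_irrefl mult_pos_pos)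
  qed
  define b' where "b' j = (if testlet j = g then c * ?b j - s * ?w j else ?b j)" for j
  define w' where "w' j = (if testlet j = g then s * ?b j + c * ?w j else ?w j)" for j
  have rot: "b' i * b' j + w' i * w' j = ?b i * ?b j + ?w i * ?w j" if "testlet i = g" "testlet j = g" for i j
  proof -
    have "b' i * b' j + w' i * w' j = (c * c + s * s) * (?b i * ?b j + ?w i * ?w j)"
      using that by (simp add: b'_def w'_def algebra_simps)
    then show ?thesis by (simp add: cs)
  qed
  show ?thesis
  proof (rule not_identifiableI[OF ta ps, where b = b' and w = w' and p = p])
    show "(b' j)\<^sup>2 + (w' j)\<^sup>2 < 1" for j
      using rot[of j j] std_norm_less_1[of testlet A j]
      by (cases "testlet j = g") (auto simp: power2_eq_square b'_def w'_def)
    show "item_corr testlet b' w' i j = item_corr testlet ?b ?w i j" if "i < J" "j < J" "i \<noteq> j" for i j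
    proof (cases "testlet i = g \<and> testlet j = g")
      case True
      then show ?thesis using rot[of i j] by (simp add: item_corr_def)
    next
      case False
      then show ?thesis using zero that by (auto simp: item_corr_def b'_def w'_def)
    qed
    have "b' p = 0" using p(2) by (simp add: b'_def c_def s_def)
    then show "\<bar>b' p\<bar> \<noteq> \<bar>?b p\<bar> \<or> \<bar>w' p\<bar> \<noteq> \<bar>?w p\<bar>" using p(3) by simp
  qed (rule p(1))
qed

text \<open>
The main loadings are multiplied by \<open>sqrt t\<close> in \<open>g\<close> and divided by it in \<open>h\<close>, which preserves the products
across the two testlets; elsewhere they vanish. Inside each of the two testlets the deformation of the
testlet loadings makes up for the change, with parameter \<open>t\<close> in \<open>g\<close> and \<open>1 / t\<close> in \<open>h\<close>. Both
deformations exist for all \<open>t\<close> sufficiently close to 1, so some \<open>t \<noteq> 1\<close> serves both.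
\<close>

lemma not_identifiable_two_main_testlets:
  assumes ta: "testlet_assignment J G testlet" and ps: "(A, d) \<in> parameter_space J G testlet"
    and gh: "g \<noteq> h"
    and zero: "\<And>j. j < J \<Longrightarrow> testlet j \<noteq> g \<Longrightarrow> testlet j \<noteq> h \<Longrightarrow> std_main testlet A j = 0"
    and p: "p < J" "testlet p = g" "std_main testlet A p \<noteq> 0"
    and ns: "\<And>k. k \<in> {g, h} \<Longrightarrow> \<not> has_disjoint_bases (testlet_items J testlet k) (std_main testlet A) (std_testlet testlet A)"
    and card: "\<And>k. k \<in> {g, h} \<Longrightarrow> card {j \<in> testlet_items J testlet k. std_testlet testlet A j \<noteq> 0} \<ge> 3"
  shows "\<not> identifiable_at J G testlet A d"
proof -
  let ?b = "std_main testlet A" and ?w = "std_testlet testlet A"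
  have fin: "finite (testlet_items J testlet k)" for k by (simp add: testlet_items_def)
  define ok where "ok B t v \<longleftrightarrow> (\<forall>i\<in>B. t * (?b i)\<^sup>2 + (v i)\<^sup>2 < 1) \<and>
    (\<forall>i\<in>B. \<forall>j\<in>B. i \<noteq> j \<longrightarrow> t * (?b i * ?b j) + v i * v j = ?b i * ?b j + ?w i * ?w j)" for B and t :: real and v
  have deform: "\<exists>v. \<forall>\<^sub>F t in at 1. ok (testlet_items J testlet k) t (v t)" if "k \<in> {g, h}" for k
    unfolding ok_def by (rule testlet_deformation_bounded[OF fin ns[OF that] card[OF that] std_norm_less_1])
  obtain V where V: "\<forall>\<^sub>F t in at 1. ok (testlet_items J testlet g) t (V t)" using deform[of g] by blast
  obtain W where W: "\<forall>\<^sub>F t in at 1. ok (testlet_items J testlet h) t (W t)" using deform[of h] by blast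
  have pos: "\<forall>\<^sub>F t in at 1. (t::real) > 0"
    by (rule order_tendstoD[OF tendsto_ident_at]) simp
  have ne: "\<forall>\<^sub>F t in at 1. (t::real) \<noteq> 1" by (rule eventually_neq_at_within)
  have "filterlim (\<lambda>t. 1 / t) (at 1) (at (1::real))"
    unfolding filterlim_at
  proof
    show "\<forall>\<^sub>F t in at 1. 1 / t \<in> UNIV \<and> 1 / t \<noteq> (1::real)"
      using ne pos by eventually_elim simp
    show "((\<lambda>t. 1 / t) \<longlongrightarrow> 1) (at (1::real))" by (auto intro!: tendsto_eq_intros)
  qed
  then have W': "\<forall>\<^sub>F t in at 1. ok (testlet_items J testlet h) (1 / t) (W (1 / t))"
    by (rule eventually_compose_filterlim[OF W])
  have "\<forall>\<^sub>F t in at 1. t > 0 \<and> t \<noteq> 1 \<and> ok (testlet_items J testlet g) t (V t) \<and> ok (testlet_items J testlet h) (1 / t) (W (1 / t))"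
    using pos ne V W' by eventually_elim simp
  then obtain t where t: "t > 0" "t \<noteq> 1" and okg: "ok (testlet_items J testlet g) t (V t)"
    and okh: "ok (testlet_items J testlet h) (1 / t) (W (1 / t))"
    using eventually_happens[of _ "at (1::real)"] by (auto simp: trivial_limit_at)
  define r where "r = sqrt t"
  have r: "r > 0" "r \<noteq> 1" "r * r = t" "r\<^sup>2 = t" using t by (simp_all add: r_def)
  define b' where "b' j = (if testlet j = g then r * ?b j else if testlet j = h then ?b j / r else ?b j)" for j
  define w' where "w' j = (if testlet j = g then V t j else if testlet j = h then W (1 / t) j else ?w j)" for j
  show ?thesis
  proof (rule not_identifiableI[OF ta ps, where b = b' and w = w' and p = p])
    show "(b' j)\<^sup>2 + (w' j)\<^sup>2 < 1" if "j < J" for j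
    proof -
      consider "testlet j = g" | "testlet j = h" "testlet j \<noteq> g" | "testlet j \<noteq> g" "testlet j \<noteq> h" by blast
      then show ?thesis
      proof cases
        case 1
        then have "j \<in> testlet_items J testlet g" using that by (simp add: testlet_items_def)
        then show ?thesis using okg 1 by (simp add: ok_def b'_def w'_def power_mult_distrib r)
      next
        case 2
        then have "j \<in> testlet_items J testlet h" using that by (simp add: testlet_items_def)
        then have "1 / t * (?b j)\<^sup>2 + (W (1 / t) j)\<^sup>2 < 1" using okh unfolding ok_def by blast
        then show ?thesis using 2 gh by (simp add: b'_def w'_def power_divide r)
      next
        case 3
        then show ?thesis using std_norm_less_1 by (simp add: b'_def w'_def)
      qed
    qed
    show "item_corr testlet b' w' i j = item_corr testlet ?b ?w i j" if ij: "i < J" "j < J" "i \<noteq> j" for i j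
    proof (cases "testlet i = testlet j")
      case True
      consider "testlet j = g" | "testlet j = h" "testlet j \<noteq> g" | "testlet j \<noteq> g" "testlet j \<noteq> h" by blast
      then show ?thesis
      proof cases
        case 1
        then have "i \<in> testlet_items J testlet g" "j \<in> testlet_items J testlet g"
          using ij True by (simp_all add: testlet_items_def)
        then have "t * (?b i * ?b j) + V t i * V t j = ?b i * ?b j + ?w i * ?w j"
          using okg ij(3) unfolding ok_def by blast
        moreover have "r * ?b i * (r * ?b j) = t * (?b i * ?b j)" unfolding r(3)[symmetric] by (simp only: mult_ac)
        ultimately show ?thesis using 1 True by (simp only: item_corr_def b'_def w'_def if_True simp_thms)
      next
        case 2
        then have "i \<in> testlet_items J testlet h" "j \<in> testlet_items J testlet h"
          using ij True by (simp_all add: testlet_items_def)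
        then have "1 / t * (?b i * ?b j) + W (1 / t) i * W (1 / t) j = ?b i * ?b j + ?w i * ?w j"
          using okh ij(3) unfolding ok_def by blast
        moreover have "?b i / r * (?b j / r) = 1 / t * (?b i * ?b j)" unfolding r(3)[symmetric] by simp
        ultimately show ?thesis using 2 gh True r(3) by (simp add: item_corr_def b'_def w'_def)
      next
        case 3
        then show ?thesis using True by (simp add: item_corr_def b'_def w'_def)
      qed
    next
      case False
      have "b' i * b' j = ?b i * ?b j"
      proof (cases "?b i = 0 \<or> ?b j = 0")
        case True
        then show ?thesis by (auto simp: b'_def)
      next
        case nz: False
        then have "testlet i = g \<and> testlet j = h \<or> testlet i = h \<and> testlet j = g"
          using False zero[OF ij(1)] zero[OF ij(2)] by metis
        then show ?thesis using gh r(1) by (auto simp: b'_def)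
      qed
      then show ?thesis using False by (simp add: item_corr_def)
    qed
    have "\<bar>b' p\<bar> = r * \<bar>?b p\<bar>" using p(2) r(1) by (simp add: b'_def abs_mult)
    then show "\<bar>b' p\<bar> \<noteq> \<bar>?b p\<bar> \<or> \<bar>w' p\<bar> \<noteq> \<bar>?w p\<bar>" using p(3) r(2) by simp
  qed (rule p(1))
qed

section \<open>Characterisation of identifiability\<close>

theorem theorem6:
  fixes J G :: nat and testlet :: "nat \<Rightarrow> nat" and A :: "real mat" and d :: "real vec"
  assumes "G \<ge> 1"
    and "testlet_assignment J G testlet"
    and "(A, d) \<in> parameter_space J G testlet"
  shows "identifiable_at J G testlet A d \<longleftrightarrow>
    (card (H1_set J G testlet A) \<ge> 3 \<and> (\<forall>g\<in>{1..G}. card (Q_set J A g) \<ge> 3)) \<or>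
    (card (H1_set J G testlet A) = 2 \<and> H2_set J G testlet A \<noteq> {} \<and>
      (\<forall>g\<in>{1..G}. card (Q_set J A g) \<ge> 3))"
proof
  note ta = assms(2) and ps = assms(3)
  let ?b = "std_main testlet A" and ?w = "std_testlet testlet A" and ?H1 = "H1_set J G testlet A"
  assume "(card ?H1 \<ge> 3 \<and> (\<forall>g\<in>{1..G}. card (Q_set J A g) \<ge> 3)) \<or>
    (card ?H1 = 2 \<and> H2_set J G testlet A \<noteq> {} \<and> (\<forall>g\<in>{1..G}. card (Q_set J A g) \<ge> 3))"
  then have H: "card ?H1 \<ge> 3 \<or> card ?H1 = 2 \<and> H2_set J G testlet A \<noteq> {}"
    and Q: "\<forall>g\<in>{1..G}. card (Q_set J A g) \<ge> 3" by blast+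
  have card: "card {j \<in> testlet_items J testlet g. ?w j \<noteq> 0} \<ge> 3" if "g \<in> {1..G}" for g
    using bspec[OF Q that] unfolding Q_set_eq[OF ps that] .
  show "identifiable_at J G testlet A d"
  proof (rule identifiableI[OF ta ps])
    fix b w
    assume corr: "\<And>i j. i < J \<Longrightarrow> j < J \<Longrightarrow> i \<noteq> j \<Longrightarrow> item_corr testlet b w i j = item_corr testlet ?b ?w i j"
    have main: "\<exists>\<epsilon>\<in>{1, -1}. \<forall>j\<in>{..<J}. b j = \<epsilon> * ?b j"
      using H
    proof
      assume c3: "card ?H1 \<ge> 3"
      obtain g1 where g1: "g1 \<in> ?H1" using card_ge_3_avoid[OF c3] by blast
      obtain g2 where g2: "g2 \<in> ?H1" "g2 \<noteq> g1" using card_ge_3_avoid[OF c3, of g1 g1] by blast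
      obtain g3 where g3: "g3 \<in> ?H1" "g3 \<noteq> g1" "g3 \<noteq> g2" using card_ge_3_avoid[OF c3, of g1 g2] by blast
      have item: "\<exists>j<J. testlet j = g \<and> ?b j \<noteq> 0" if "g \<in> ?H1" for g
        using that by (auto simp: mem_H1_set_iff testlet_items_def)
      obtain i j k where "i < J" "testlet i = g1" "?b i \<noteq> 0" "j < J" "testlet j = g2" "?b j \<noteq> 0"
        "k < J" "testlet k = g3" "?b k \<noteq> 0"
        using item[OF g1] item[OF g2(1)] item[OF g3(1)] by blast
      then show ?thesis
        using g2 g3 by (intro main_loadings_determined_three_testlets[OF corr, where i = i and j = j and k = k]) auto
    next
      assume c2: "card ?H1 = 2 \<and> H2_set J G testlet A \<noteq> {}"
      then obtain g where g: "has_disjoint_bases (testlet_items J testlet g) ?b ?w"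
        using mem_H2_set_iff[OF ps] by blast
      have "\<not> ?H1 \<subseteq> {g}"
        using c2 card_mono[of "{g}" ?H1] by auto
      then obtain h where h: "h \<in> ?H1" "h \<noteq> g" by blast
      then obtain m where "m < J" "testlet m \<noteq> g" "?b m \<noteq> 0"
        by (auto simp: mem_H1_set_iff testlet_items_def)
      then show ?thesis
        by (intro main_loadings_determined_two_testlets[OF corr g, where m = m]) auto
    qed
    moreover have "\<forall>g\<in>{1..G}. \<exists>\<epsilon>\<in>{1, -1}. \<forall>j\<in>testlet_items J testlet g. w j = \<epsilon> * ?w j"
      using testlet_loadings_determined_up_to_sign[OF corr main card] by blast
    ultimately show "(\<exists>\<epsilon>\<in>{1, -1}. \<forall>j\<in>{..<J}. b j = \<epsilon> * ?b j) \<and>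
        (\<forall>g\<in>{1..G}. \<exists>\<epsilon>\<in>{1, -1}. \<forall>j\<in>testlet_items J testlet g. w j = \<epsilon> * ?w j)" ..
  qed
next
  note ta = assms(2) and ps = assms(3)
  let ?b = "std_main testlet A" and ?w = "std_testlet testlet A" and ?H1 = "H1_set J G testlet A"
  assume ident: "identifiable_at J G testlet A d"
  have card: "card {j \<in> testlet_items J testlet g. ?w j \<noteq> 0} \<ge> 3" if "g \<in> {1..G}" for g
    using not_identifiable_few_testlet_loadings[OF ta ps that] ident by (meson not_le)
  have range: "testlet j \<in> {1..G}" if "j < J" for j using testlet_range[OF ta that] by simp
  have zero: "?b j = 0" if "j < J" "testlet j \<notin> ?H1" for j
    using that range[OF that(1)] by (auto simp: mem_H1_set_iff testlet_items_def)
  have J: "0 < J"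
    using ta assms(1) by (cases J) (auto simp: testlet_assignment_def)
  have fin: "finite ?H1" by (simp add: H1_set_def)
  have "card ?H1 \<noteq> 0"
    using not_identifiable_no_main_loading[OF ta ps J] zero ident fin by auto
  moreover have "card ?H1 \<noteq> 1"
  proof
    assume "card ?H1 = 1"
    then obtain g where g: "?H1 = {g}" by (rule card_1_singletonE)
    then obtain p where "p < J" "testlet p = g" "?b p \<noteq> 0"
      using mem_H1_set_iff[of g J G testlet A] by (auto simp: testlet_items_def)
    then show False
      using not_identifiable_one_main_testlet[OF ta ps, of g p] zero g ident by simp
  qed
  moreover have "H2_set J G testlet A \<noteq> {}" if c2: "card ?H1 = 2"
  proof
    assume H2: "H2_set J G testlet A = {}"
    obtain g h where gh: "?H1 = {g, h}" "g \<noteq> h" using c2 by (auto simp: card_2_iff)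
    then have G: "g \<in> {1..G}" "h \<in> {1..G}" using mem_H1_set_iff by blast+
    obtain p where p: "p < J" "testlet p = g" "?b p \<noteq> 0"
      using gh mem_H1_set_iff[of g J G testlet A] by (auto simp: testlet_items_def)
    have "\<not> identifiable_at J G testlet A d"
    proof (rule not_identifiable_two_main_testlets[OF ta ps gh(2) _ p])
      show "?b j = 0" if "j < J" "testlet j \<noteq> g" "testlet j \<noteq> h" for j
        using zero[OF that(1)] that gh(1) by simp
      show "\<not> has_disjoint_bases (testlet_items J testlet k) ?b ?w" if "k \<in> {g, h}" for k
        using H2 mem_H2_set_iff[OF ps, of k] that G by auto
      show "3 \<le> card {j \<in> testlet_items J testlet k. ?w j \<noteq> 0}" if "k \<in> {g, h}" for k
        using card that G by blast
    qed
    then show False using ident by simp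
  qed
  ultimately show "(card ?H1 \<ge> 3 \<and> (\<forall>g\<in>{1..G}. card (Q_set J A g) \<ge> 3)) \<or>
    (card ?H1 = 2 \<and> H2_set J G testlet A \<noteq> {} \<and> (\<forall>g\<in>{1..G}. card (Q_set J A g) \<ge> 3))"
    using card Q_set_eq[OF ps] by force
qed

end
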